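(* Let $r\in\mathbb R$ and let $\mathcal E,\mathcal F$ be finite sequences of non-zero complex numbers all of absolute value at most $r<1$. Then $$\int_{U(N)}\prod_{\varepsilon\in\mathcal E}\varepsilon\frac{\Lambda_g'(\varepsilon)}{\Lambda_g(\varepsilon)}\prod_{\varphi\in\mathcal F}\varphi\frac{\Lambda_{g^{-1}}'(\varphi)}{\Lambda_{g^{-1}}(\varphi)}\,dg=\sum_\lambda\left(-\frac N2\right)^{l(\mathcal E)+l(\mathcal F)-2l(\lambda)}z_\lambda\,\mathfrak m_\lambda(\mathcal E)\,\mathfrak m_\lambda(\mathcal F)+O_{r,l(\mathcal E),l(\mathcal F)}\!\left(r^{2N}N^{l(\mathcal E)+l(\mathcal F)+(l(\mathcal E)-1)^++(l(\mathcal F)-1)^++(l(\mathcal E)+l(\mathcal F)-1)^++2}\right),$$ the sum running over all partitions $\lambda$.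
   Context: $U(N)$ is the unitary group with normalized Haar measure. $\chi_g(z)=\det(I-zg^{-1})$. For $g\in U(N)$ with $\det(-g)\ne-1$ (a Haar-null condition), the completed characteristic polynomial is $\Lambda_g(z)=\det(-g)^{1/2}z^{-N/2}\chi_g(z)$ on $\mathbb C\setminus\mathbb R_{\le0}$; its logarithmic derivative is $\Lambda_g'(z)/\Lambda_g(z)=-N/(2z)+\chi_g'(z)/\chi_g(z)$. $l(\cdot)$ denotes length (number of entries of a sequence, number of positive parts of a partition), $x^+=\max\{x,0\}$, $m_i(\lambda)$ is the number of parts of $\lambda$ equal to $i$, $z_\lambda=\prod_i i^{m_i(\lambda)}m_i(\lambda)!$, and $\mathfrak m_\lambda$ is the monomial symmetric polynomial (zero if $l(\lambda)$ exceeds the number of variables). *)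

theory Defs
  imports
    "HOL-Probability.Probability_Measure"
    "HOL-Combinatorics.Multiset_Permutations"
    "Jordan_Normal_Form.Schur_Decomposition"
begin

hide_const (open) Determinants.det

section \<open>The unitary group and its Haar measure\<close>

text \<open>Matrices are those of \<^theory>\<open>Jordan_Normal_Form.Matrix\<close>, because the size \<open>N\<close> has to
  be quantified inside the main statement.\<close>

definition unitary_group :: "nat \<Rightarrow> complex mat monoid" where
  "unitary_group N =
     \<lparr>carrier = {g \<in> carrier_mat N N. g * mat_adjoint g = 1\<^sub>m N},
      monoid.mult = (*), one = 1\<^sub>m N\<rparr>"

text \<open>The Borel sets of \<open>U(N)\<close> as a subspace of \<open>\<complex>\<close> to the power \<open>N \<times> N\<close>. A finite product of
  copies of the Borel algebra of \<open>\<complex>\<close> is the Borel algebra of the product space.\<close>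

definition unitary_borel :: "nat \<Rightarrow> complex mat measure" where
  "unitary_borel N =
     vimage_algebra (carrier (unitary_group N))
       (\<lambda>g. \<lambda>(i, j)\<in>{..<N} \<times> {..<N}. g $$ (i, j))
       (\<Pi>\<^sub>M ij\<in>{..<N} \<times> {..<N}. borel)"

definition normalized_haar :: "nat \<Rightarrow> complex mat measure \<Rightarrow> bool" where
  "normalized_haar N \<mu> \<longleftrightarrow>
     prob_space \<mu> \<and> sets \<mu> = sets (unitary_borel N) \<and>
     (\<forall>h\<in>carrier (unitary_group N). distr \<mu> \<mu> (\<lambda>g. h \<otimes>\<^bsub>unitary_group N\<^esub> g) = \<mu>)"


section \<open>Completed characteristic polynomials\<close>

definition chi :: "nat \<Rightarrow> complex mat \<Rightarrow> complex \<Rightarrow> complex" where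
  "chi N g z = det (1\<^sub>m N - z \<cdot>\<^sub>m inv\<^bsub>unitary_group N\<^esub> g)"

text \<open>Principal branches throughout; meant for \<open>det (- g) \<noteq> -1\<close> and \<open>z\<close> off the non-positive
  real axis.\<close>

definition Lambda :: "nat \<Rightarrow> complex mat \<Rightarrow> complex \<Rightarrow> complex" where
  "Lambda N g z = csqrt (det (- g)) * z powr (- of_nat N / 2) * chi N g z"

text \<open>The logarithmic derivative of \<open>Lambda\<close>. This expression does not involve the branch cut and
  is the meaning of the logarithmic derivative at negative real \<open>z\<close> as well; lemma
  \<open>logderiv_Lambda\<close> below identifies it with the quotient of \<open>deriv (Lambda N g) z\<close> by
  \<open>Lambda N g z\<close> elsewhere.\<close>

definition Lambda_logderiv :: "nat \<Rightarrow> complex mat \<Rightarrow> complex \<Rightarrow> complex" where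
  "Lambda_logderiv N g z = - of_nat N / (2 * z) + deriv (chi N g) z / chi N g z"


section \<open>Partitions and monomial symmetric polynomials\<close>

text \<open>A partition is the multiset of its positive parts, so that \<open>l(\<nu>)\<close> is \<open>size \<nu>\<close> and
  \<open>m\<^sub>i(\<nu>)\<close> is \<open>count \<nu> i\<close>.\<close>

definition partitions :: "nat multiset set" where
  "partitions = {\<nu>. 0 \<notin># \<nu>}"

definition z_part :: "nat multiset \<Rightarrow> nat" where
  "z_part \<nu> = (\<Prod>i\<in>set_mset \<nu>. i ^ count \<nu> i * fact (count \<nu> i))"

text \<open>The sum ranges over the distinct rearrangements of \<open>\<nu>\<close> padded with zeros.\<close>

definition monomial_sym :: "nat multiset \<Rightarrow> complex list \<Rightarrow> complex" where
  "monomial_sym \<nu> xs =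
     (if size \<nu> \<le> length xs then
        \<Sum>\<alpha>\<in>permutations_of_multiset (\<nu> + replicate_mset (length xs - size \<nu>) 0).
          \<Prod>i<length xs. xs ! i ^ (\<alpha> ! i)
      else 0)"


section \<open>Consistency of the definitions\<close>

lemma mat_adjoint_carrier:
  "(g :: complex mat) \<in> carrier_mat N N \<Longrightarrow> mat_adjoint g \<in> carrier_mat N N"
  unfolding mat_adjoint_def by (metis carrier_matD cols_length length_map mat_of_rows_carrier(1))

lemma mat_adjoint_index:
  assumes "(g :: complex mat) \<in> carrier_mat N N" "i < N" "j < N"
  shows "mat_adjoint g $$ (i, j) = cnj (g $$ (j, i))"
  using assms by (simp add: mat_adjoint_def mat_of_rows_def)

lemma mat_adjoint_adjoint:
  assumes "(g :: complex mat) \<in> carrier_mat N N"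
  shows "mat_adjoint (mat_adjoint g) = g"
  using assms mat_adjoint_carrier[OF assms] mat_adjoint_carrier[OF mat_adjoint_carrier[OF assms]]
  by (intro eq_matI) (auto simp: mat_adjoint_index)

lemma mat_adjoint_mult:
  assumes g: "(g :: complex mat) \<in> carrier_mat N N" and h: "h \<in> carrier_mat N N"
  shows "mat_adjoint (g * h) = mat_adjoint h * mat_adjoint g"
proof -
  have gh: "g * h \<in> carrier_mat N N" using g h by simp
  note idx = mat_adjoint_index[OF g] mat_adjoint_index[OF h] mat_adjoint_index[OF gh]
  show ?thesis
    using g h gh mat_adjoint_carrier[OF g] mat_adjoint_carrier[OF h] mat_adjoint_carrier[OF gh]
    by (intro eq_matI) (auto simp: idx scalar_prod_def mult.commute)
qed

lemma mat_adjoint_one: "mat_adjoint (1\<^sub>m N :: complex mat) = 1\<^sub>m N"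
  using mat_adjoint_carrier[of "1\<^sub>m N" N]
  by (intro eq_matI) (auto simp: mat_adjoint_index[of "1\<^sub>m N" N])

lemma adjoint_mult_self:
  assumes "g \<in> carrier (unitary_group N)"
  shows "mat_adjoint g * g = 1\<^sub>m N"
  using assms mat_adjoint_carrier[of g N] mat_mult_left_right_inverse[of g N "mat_adjoint g"]
  by (auto simp: unitary_group_def)

lemma adjoint_unitary:
  assumes "g \<in> carrier (unitary_group N)"
  shows "mat_adjoint g \<in> carrier (unitary_group N)"
  using assms adjoint_mult_self[OF assms] mat_adjoint_carrier[of g N]
  by (auto simp: unitary_group_def mat_adjoint_adjoint[of g N])

lemma group_unitary_group: "group (unitary_group N)"
proof (rule groupI)
  fix x y assume xy: "x \<in> carrier (unitary_group N)" "y \<in> carrier (unitary_group N)"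
  then have c: "x \<in> carrier_mat N N" "y \<in> carrier_mat N N"
    and u: "x * mat_adjoint x = 1\<^sub>m N" "y * mat_adjoint y = 1\<^sub>m N"
    by (auto simp: unitary_group_def)
  have a: "mat_adjoint x \<in> carrier_mat N N" "mat_adjoint y \<in> carrier_mat N N"
    using c by (auto intro: mat_adjoint_carrier)
  have "(x * y) * (mat_adjoint y * mat_adjoint x) = x * (y * mat_adjoint y) * mat_adjoint x"
    using a c by (simp add: assoc_mult_mat[of _ N N _ N _ N])
  also have "\<dots> = 1\<^sub>m N" using u c by simp
  finally show "x \<otimes>\<^bsub>unitary_group N\<^esub> y \<in> carrier (unitary_group N)"
    using c by (simp add: unitary_group_def mat_adjoint_mult)
next
  show "\<one>\<^bsub>unitary_group N\<^esub> \<in> carrier (unitary_group N)"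
    by (simp add: unitary_group_def mat_adjoint_one)
next
  fix x assume x: "x \<in> carrier (unitary_group N)"
  then show "\<one>\<^bsub>unitary_group N\<^esub> \<otimes>\<^bsub>unitary_group N\<^esub> x = x"
    by (auto simp: unitary_group_def)
  show "\<exists>y\<in>carrier (unitary_group N). y \<otimes>\<^bsub>unitary_group N\<^esub> x = \<one>\<^bsub>unitary_group N\<^esub>"
    using adjoint_unitary[OF x] adjoint_mult_self[OF x] by (auto simp: unitary_group_def)
qed (auto simp: unitary_group_def intro!: assoc_mult_mat)

lemma inv_unitary_group:
  assumes "g \<in> carrier (unitary_group N)"
  shows "inv\<^bsub>unitary_group N\<^esub> g = mat_adjoint g"
  by (rule group.inv_equality[OF group_unitary_group _ assms adjoint_unitary[OF assms]])
    (use adjoint_mult_self[OF assms] in \<open>simp add: unitary_group_def\<close>)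

lemma chi_differentiable:
  assumes "g \<in> carrier (unitary_group N)"
  shows "chi N g field_differentiable at z"
proof -
  define h where "h = inv\<^bsub>unitary_group N\<^esub> g"
  have h: "h \<in> carrier_mat N N"
    using group.inv_closed[OF group_unitary_group assms]
    by (auto simp: h_def unitary_group_def)
  have "chi N g = (\<lambda>z. \<Sum>p | p permutes {0..<N}.
      signof p * (\<Prod>i = 0..<N. (1\<^sub>m N $$ (i, p i) - z * h $$ (i, p i))))"
  proof
    fix z
    have "1\<^sub>m N - z \<cdot>\<^sub>m h \<in> carrier_mat N N"
      using h by (intro minus_carrier_mat smult_carrier_mat)
    then show "chi N g z = (\<Sum>p | p permutes {0..<N}.
      signof p * (\<Prod>i = 0..<N. (1\<^sub>m N $$ (i, p i) - z * h $$ (i, p i))))"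
      unfolding chi_def h_def[symmetric] det_def'[OF \<open>1\<^sub>m N - z \<cdot>\<^sub>m h \<in> carrier_mat N N\<close>]
      using h by (intro sum.cong refl arg_cong2[where f = "(*)"] prod.cong)
        (auto dest: permutes_in_image)
  qed
  moreover have "(\<lambda>z. \<Sum>p | p permutes {0..<N}.
      signof p * (\<Prod>i = 0..<N. (1\<^sub>m N $$ (i, p i) - z * h $$ (i, p i)))) holomorphic_on UNIV"
    by (intro holomorphic_intros)
  ultimately show ?thesis
    by (simp add: holomorphic_on_open field_differentiable_def)
qed

lemma logderiv_Lambda:
  assumes g: "g \<in> carrier (unitary_group N)"
    and z: "z \<notin> \<real>\<^sub>\<le>\<^sub>0" and nz: "chi N g z \<noteq> 0"
  shows "deriv (Lambda N g) z / Lambda N g z = Lambda_logderiv N g z"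
proof -
  have z0: "z \<noteq> 0" using z by auto
  have "det g * det (mat_adjoint g) = 1"
    using g det_mult[of g N "mat_adjoint g"] mat_adjoint_carrier[of g N]
    by (auto simp: unitary_group_def)
  then have "det g \<noteq> 0" by auto
  moreover have "- g = (- 1) \<cdot>\<^sub>m g" by (intro eq_matI) auto
  ultimately have d: "csqrt (det (- g)) \<noteq> 0" by (simp add: det_smult)
  have chi: "(chi N g has_field_derivative deriv (chi N g) z) (at z)"
    using chi_differentiable[OF g] by (simp add: DERIV_deriv_iff_field_differentiable)
  define s where "s = - (of_nat N :: complex) / 2"
  have "(Lambda N g has_field_derivative
      csqrt (det (- g)) * (s * z powr (s - 1) * chi N g z + z powr s * deriv (chi N g) z)) (at z)"
    unfolding Lambda_def s_def[symmetric] using z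
    by (auto intro!: derivative_eq_intros chi simp: algebra_simps)
  then have D: "deriv (Lambda N g) z =
      csqrt (det (- g)) * (s * z powr (s - 1) * chi N g z + z powr s * deriv (chi N g) z)"
    by (rule DERIV_imp_deriv)
  have p: "z powr (s - 1) = z powr s / z" "z powr s \<noteq> 0"
    using z0 by (auto simp: powr_diff)
  show ?thesis
    unfolding D Lambda_logderiv_def Lambda_def s_def[symmetric] p(1)
    using d p(2) nz z0 by (simp add: field_simps s_def)
qed

end

theory Submission
  imports Defs
begin

text \<open>Write \<open>p\<^sub>a = tr g\<^sup>a\<close>. For small \<open>z\<close> the factor at \<open>z\<close> is the power series
  \<open>- N/2 - \<Sum>\<^sub>a z\<^sup>a p\<^sub>a\<^sup>*\<close>, respectively \<open>- N/2 - \<Sum>\<^sub>a z\<^sup>a p\<^sub>a\<close>, so the integrand is a power series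
  in products \<open>p\<^sub>\<kappa> p\<^sub>\<nu>\<^sup>*\<close>. The integral of such a product vanishes unless \<open>\<bar>\<kappa>\<bar> = \<bar>\<nu>\<bar>\<close>, and it is
  \<open>z\<^sub>\<kappa>\<close> for \<open>\<kappa> = \<nu>\<close> and \<open>0\<close> otherwise as long as \<open>\<bar>\<kappa>\<bar> = \<bar>\<nu>\<bar> \<le> N\<close>. These degrees reproduce the
  sum over partitions. In degree \<open>n > N\<close> the integral is bounded trivially, by a power of \<open>N n\<close> times
  \<open>r\<^sup>2\<^sup>n\<close>, as is the part of the partition sum in degree \<open>n\<close>.

  The moments are computed without representation theory. Left invariance in infinitesimal form
  gives loop equations between the moments of a given degree \<open>n\<close>, modulo lower degrees. The
  covariances of independent Gaussian variables satisfy the same equations, and for \<open>n \<le> N\<close> the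
  linear system is strictly diagonally dominant, hence has only one solution.\<close>

section \<open>Power traces and the logarithmic derivative of the characteristic polynomial\<close>

text \<open>Derivatives are taken with Taylor remainders bounded uniformly over the group, so
  invariance of the measure turns directly into vanishing integrals, without exchanging limits. A
  loop equation built on a part \<open>a\<close> has one distinguished term, in which the trace of a
  zeroth power contributes the factor \<open>N\<close>. Its other terms of the same degree split
  \<open>a\<close> or join it to another part, while everything coming from the conjugated factor
  has lost degree; this is what makes induction on the degree possible. Above degree
  \<open>N\<close> nothing better than the bound by \<open>N\<close> on each trace is used. In
  degree N + 1 + m the polynomial factors in the degree are at most powers of \<open>N\<close> times
  powers of m + 3, so the powers of \<open>N\<close> can be pulled out of the tail, and a convergent
  series in m, depending only on r and the two lengths, remains as the constant.\<close>

definition mat_trace :: "complex mat \<Rightarrow> complex" where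
  "mat_trace A = (\<Sum>i<dim_row A. A $$ (i, i))"

lemma index_mult_mat_sum:
  assumes "A \<in> carrier_mat n m" "B \<in> carrier_mat m p" "i < n" "j < p"
  shows "(A * B) $$ (i, j) = (\<Sum>k<m. A $$ (i, k) * B $$ (k, j))"
  using assms by (auto simp: scalar_prod_def atLeast0LessThan)

lemma mat_trace_mult_commute:
  assumes "A \<in> carrier_mat n n" "B \<in> carrier_mat n n"
  shows "mat_trace (A * B) = mat_trace (B * A)"
proof -
  have "mat_trace (A * B) = (\<Sum>i<n. \<Sum>k<n. A $$ (i, k) * B $$ (k, i))"
    using assms by (auto simp: mat_trace_def index_mult_mat_sum[of A n n B n] simp del: index_mult_mat(1))
  also have "\<dots> = (\<Sum>k<n. \<Sum>i<n. A $$ (i, k) * B $$ (k, i))"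
    by (rule sum.swap)
  also have "\<dots> = mat_trace (B * A)"
    using assms by (auto simp: mat_trace_def index_mult_mat_sum[of B n n A n] mult.commute
        simp del: index_mult_mat(1))
  finally show ?thesis .
qed

lemma mat_trace_similar:
  assumes "similar_mat_wit A B P Q"
  shows "mat_trace A = mat_trace B"
proof -
  define n where "n = dim_row A"
  note wit = similar_mat_witD[OF n_def assms]
  have "mat_trace (P * B * Q) = mat_trace (Q * (P * B))"
    using wit by (intro mat_trace_mult_commute[of _ n]) auto
  also have "Q * (P * B) = B"
    using wit assoc_mult_mat[of Q n n P n B n] by simp
  finally show ?thesis using wit by simp
qed

lemma upper_triangular_pow:
  assumes T: "T \<in> carrier_mat n n" "upper_triangular T"
  shows "upper_triangular (T ^\<^sub>m a) \<and> (\<forall>i<n. (T ^\<^sub>m a) $$ (i, i) = (T $$ (i, i)) ^ a)"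
proof (induction a)
  case 0
  then show ?case using T by auto
next
  case (Suc a)
  have c: "T ^\<^sub>m a \<in> carrier_mat n n" using T by simp
  have idx: "(T ^\<^sub>m Suc a) $$ (i, j) = (\<Sum>k<n. (T ^\<^sub>m a) $$ (i, k) * T $$ (k, j))"
    if "i < n" "j < n" for i j
    using index_mult_mat_sum[OF c T(1) that] by simp
  have van: "(T ^\<^sub>m a) $$ (i, k) * T $$ (k, j) = 0" if "j \<le> i" "i < n" "k < n" "k \<noteq> i \<or> j \<noteq> i" for i j k
  proof (cases "k < i")
    case True
    then show ?thesis using Suc that c by (auto simp: upper_triangular_def)
  next
    case False
    then have "j < k" using that by linarith
    then show ?thesis using T that by (auto simp: upper_triangular_def)
  qed
  have "(T ^\<^sub>m Suc a) $$ (i, j) = 0" if "j < i" "i < n" for i j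
    unfolding idx[OF that(2) less_trans[OF that]] using van[of j i] that by (intro sum.neutral) auto
  moreover have "(T ^\<^sub>m Suc a) $$ (i, i) = T $$ (i, i) ^ Suc a" if "i < n" for i
  proof -
    have "(T ^\<^sub>m Suc a) $$ (i, i) = (\<Sum>k\<in>{i}. (T ^\<^sub>m a) $$ (i, k) * T $$ (k, i))"
      unfolding idx[OF that that] using van[of i i] that by (intro sum.mono_neutral_right) auto
    then show ?thesis using Suc that by (simp add: power_commutes)
  qed
  ultimately show ?case using T c by (auto simp: upper_triangular_def simp del: pow_mat.simps)
qed

section \<open>Eigenvalues of unitary matrices\<close>

lemma norm_unitary_entry_le:
  assumes g: "g \<in> carrier (unitary_group N)" and ij: "i < N" "j < N"
  shows "norm (g $$ (i, j)) \<le> 1"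
proof -
  have c: "g \<in> carrier_mat N N" and u: "g * mat_adjoint g = 1\<^sub>m N"
    using g by (auto simp: unitary_group_def)
  have "1 = (g * mat_adjoint g) $$ (i, i)" using u ij by simp
  also have "\<dots> = (\<Sum>k<N. g $$ (i, k) * cnj (g $$ (i, k)))"
    using index_mult_mat_sum[OF c mat_adjoint_carrier[OF c] ij(1) ij(1)] ij c
    by (simp add: mat_adjoint_index)
  also have "\<dots> = complex_of_real (\<Sum>k<N. (norm (g $$ (i, k)))\<^sup>2)"
    by (simp only: complex_norm_square of_real_sum)
  finally have *: "(\<Sum>k<N. (norm (g $$ (i, k)))\<^sup>2) = 1"
    using of_real_eq_iff by (metis of_real_1)
  have "(norm (g $$ (i, j)))\<^sup>2 \<le> (\<Sum>k<N. (norm (g $$ (i, k)))\<^sup>2)"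
    using ij by (intro member_le_sum) auto
  then show ?thesis unfolding * by (simp add: power_le_one_iff abs_square_le_1)
qed

lemma unitary_pow_closed:
  assumes "g \<in> carrier (unitary_group N)"
  shows "g ^\<^sub>m a \<in> carrier (unitary_group N)"
proof -
  interpret group "unitary_group N" by (rule group_unitary_group)
  have "g ^\<^sub>m a = g [^]\<^bsub>unitary_group N\<^esub> a"
    using assms by (induction a) (auto simp: unitary_group_def)
  then show ?thesis using assms by auto
qed

lemma norm_trace_unitary_pow_le:
  assumes "g \<in> carrier (unitary_group N)"
  shows "norm (mat_trace (g ^\<^sub>m a)) \<le> real N"
proof -
  have "dim_row (g ^\<^sub>m a) = N" using assms by (auto simp: unitary_group_def)
  then have "norm (mat_trace (g ^\<^sub>m a)) \<le> (\<Sum>i<N. norm ((g ^\<^sub>m a) $$ (i, i)))"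
    unfolding mat_trace_def by (metis norm_sum)
  also have "\<dots> \<le> (\<Sum>i<N. 1)"
    by (intro sum_mono norm_unitary_entry_le[OF unitary_pow_closed[OF assms]]) auto
  finally show ?thesis by simp
qed

text \<open>Turns bounded powers into a bound on an eigenvalue, which avoids eigenvectors and
  unitary diagonalization.\<close>

lemma power_bounded_imp_norm_le_1:
  fixes z :: complex
  assumes "\<And>a::nat. norm (z ^ a) \<le> C"
  shows "norm z \<le> 1"
proof (rule ccontr)
  assume "\<not> norm z \<le> 1"
  then obtain a where "C < norm z ^ a"
    using real_arch_pow[of "norm z" C] by auto
  then show False using assms[of a] by (simp add: norm_power)
qed

text \<open>Schur triangularization puts the eigenvalues on the diagonal of \<open>T\<close>, where
  the determinant and the power traces can be read off. Only similarity of \<open>h\<close> and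
  \<open>T\<close> is used, so the bound on the eigenvalues comes from the powers of
  \<open>h\<close> being unitary.\<close>

lemma unitary_eigenvalues:
  assumes h: "h \<in> carrier (unitary_group N)"
  obtains \<theta> :: "nat \<Rightarrow> complex" where
    "\<And>i. i < N \<Longrightarrow> norm (\<theta> i) \<le> 1"
    "\<And>z. det (1\<^sub>m N - z \<cdot>\<^sub>m h) = (\<Prod>i<N. 1 - z * \<theta> i)"
    "\<And>a. mat_trace (h ^\<^sub>m a) = (\<Sum>i<N. \<theta> i ^ a)"
proof -
  have hc: "h \<in> carrier_mat N N" using h by (auto simp: unitary_group_def)
  obtain es where "char_poly h = (\<Prod>a\<leftarrow>es. [:- a, 1:])"
    using char_poly_factorized[OF hc] by blast
  then obtain T where T: "T \<in> carrier_mat N N" "upper_triangular T" "similar_mat h T"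
    using schur_decomposition_exists[OF hc] by blast
  then obtain P Q where wit: "similar_mat_wit h T P Q"
    by (auto simp: similar_mat_def)
  note w = similar_mat_witD2[OF hc wit]
  have wit': "similar_mat_wit T h Q P" by (rule similar_mat_wit_sym[OF wit])
  show thesis
  proof (rule that[of "\<lambda>i. T $$ (i, i)"])
    fix i assume i: "i < N"
    \<comment> \<open>The bound must not depend on \<open>a\<close>: the powers of \<open>h\<close>
      have entries of modulus at most 1, and only the fixed conjugating matrices remain.\<close>
    have "norm ((T $$ (i, i)) ^ a) \<le> (\<Sum>k<N. \<Sum>j<N. norm (Q $$ (i, j)) * norm (P $$ (k, i)))" for a
    proof -
      have c: "h ^\<^sub>m a \<in> carrier_mat N N" using hc by simp
      have "(T $$ (i, i)) ^ a = (T ^\<^sub>m a) $$ (i, i)"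
        using upper_triangular_pow[OF T(1,2)] i by simp
      also have "\<dots> = (\<Sum>k<N. (\<Sum>j<N. Q $$ (i, j) * (h ^\<^sub>m a) $$ (j, k)) * P $$ (k, i))"
        unfolding similar_mat_wit_pow_id[OF wit']
        using index_mult_mat_sum[of "Q * h ^\<^sub>m a" N N P N i i]
          index_mult_mat_sum[of Q N N "h ^\<^sub>m a" N i] w c i by simp
      also have "norm \<dots> \<le> (\<Sum>k<N. \<Sum>j<N. norm (Q $$ (i, j)) * norm (P $$ (k, i)))"
        unfolding sum_distrib_right
      proof (intro order.trans[OF norm_sum] sum_mono)
        fix k j assume kj: "k \<in> {..<N}" "j \<in> {..<N}"
        have "norm (Q $$ (i, j)) * norm ((h ^\<^sub>m a) $$ (j, k)) * norm (P $$ (k, i))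
            \<le> norm (Q $$ (i, j)) * 1 * norm (P $$ (k, i))"
          using kj by (intro mult_right_mono mult_left_mono
              norm_unitary_entry_le[OF unitary_pow_closed[OF h]]) auto
        then show "norm (Q $$ (i, j) * (h ^\<^sub>m a) $$ (j, k) * P $$ (k, i))
            \<le> norm (Q $$ (i, j)) * norm (P $$ (k, i))"
          by (simp add: norm_mult)
      qed
      finally show ?thesis .
    qed
    then show "norm (T $$ (i, i)) \<le> 1" by (rule power_bounded_imp_norm_le_1)
  next
    fix z
    have c: "1\<^sub>m N - z \<cdot>\<^sub>m T \<in> carrier_mat N N" using T by auto
    have "P * (1\<^sub>m N - z \<cdot>\<^sub>m T) = P - z \<cdot>\<^sub>m (P * T)"
      using w(6) T(1) by (simp add: mult_minus_distrib_mat[of P N N "1\<^sub>m N" N "z \<cdot>\<^sub>m T"]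
          mult_smult_distrib[of P N N T N])
    then have "P * (1\<^sub>m N - z \<cdot>\<^sub>m T) * Q = (P - z \<cdot>\<^sub>m (P * T)) * Q" by simp
    also have "\<dots> = 1\<^sub>m N - z \<cdot>\<^sub>m h"
      using w T minus_mult_distrib_mat[of P N N "z \<cdot>\<^sub>m (P * T)" Q N]
      by (simp add: mult_smult_assoc_mat[of _ N N _ N])
    finally have "det (1\<^sub>m N - z \<cdot>\<^sub>m h) = det (P * (1\<^sub>m N - z \<cdot>\<^sub>m T) * Q)" by simp
    also have "\<dots> = det P * det Q * det (1\<^sub>m N - z \<cdot>\<^sub>m T)"
      using w c by (simp add: det_mult[of _ N])
    also have "det P * det Q = 1"
      using w det_mult[of P N Q] by simp
    also have "det (1\<^sub>m N - z \<cdot>\<^sub>m T) = prod_list (diag_mat (1\<^sub>m N - z \<cdot>\<^sub>m T))"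
      using T by (intro det_upper_triangular[OF _ c]) (auto simp: upper_triangular_def)
    also have "\<dots> = (\<Prod>i<N. 1 - z * T $$ (i, i))"
      using T by (simp add: prod_list_diag_prod atLeast0LessThan)
    finally show "det (1\<^sub>m N - z \<cdot>\<^sub>m h) = (\<Prod>i<N. 1 - z * T $$ (i, i))" by simp
  next
    fix a
    show "mat_trace (h ^\<^sub>m a) = (\<Sum>i<N. (T $$ (i, i)) ^ a)"
      using mat_trace_similar[OF similar_mat_wit_pow[OF wit, of a]] upper_triangular_pow[OF T(1,2), of a] T(1)
      by (simp add: mat_trace_def)
  qed
qed

text \<open>\<open>chi\<close> is the product of the factors \<open>1 - z * \<theta> i\<close>, so
  its logarithmic derivative is a sum of simple fractions. Each expands as a geometric series
  because the eigenvalues lie in the closed unit disc.\<close>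

lemma chi_logderiv_sums:
  assumes g: "g \<in> carrier (unitary_group N)" and h: "h = inv\<^bsub>unitary_group N\<^esub> g" and z: "norm z < 1"
  shows "(\<lambda>n. - (z ^ Suc n * mat_trace (h ^\<^sub>m Suc n))) sums (z * (deriv (chi N g) z / chi N g z))"
proof -
  have hU: "h \<in> carrier (unitary_group N)"
    using group.inv_closed[OF group_unitary_group g] h by simp
  obtain \<theta> :: "nat \<Rightarrow> complex" where \<theta>: "\<And>i. i < N \<Longrightarrow> norm (\<theta> i) \<le> 1"
    "\<And>z. det (1\<^sub>m N - z \<cdot>\<^sub>m h) = (\<Prod>i<N. 1 - z * \<theta> i)"
    "\<And>a. mat_trace (h ^\<^sub>m a) = (\<Sum>i<N. \<theta> i ^ a)"
    by (rule unitary_eigenvalues[OF hU]) blast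
  have lt: "norm (z * \<theta> i) < 1" if "i < N" for i
    using z \<theta>(1)[OF that] mult_left_le[of "norm (\<theta> i)" "norm z"] by (simp add: norm_mult)
  have nz: "1 - z * \<theta> i \<noteq> 0" if "i < N" for i
    using lt[OF that] by force
  then have prod_nz: "(\<Prod>i<N. 1 - z * \<theta> i) \<noteq> 0" by simp
  have chi: "chi N g = (\<lambda>z. \<Prod>i<N. 1 - z * \<theta> i)"
    unfolding chi_def h[symmetric] \<theta>(2) ..
  have "((\<lambda>z. \<Prod>i<N. 1 - z * \<theta> i) has_field_derivative
      (\<Prod>i<N. 1 - z * \<theta> i) * (\<Sum>i<N. - \<theta> i / (1 - z * \<theta> i))) (at z)"
    using nz by (intro has_field_derivative_prod') (auto intro!: derivative_eq_intros)
  moreover define S where "S = (\<Sum>i<N. - \<theta> i / (1 - z * \<theta> i))"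
  ultimately have "deriv (chi N g) z = chi N g z * S"
    unfolding chi S_def by (intro DERIV_imp_deriv)
  moreover have "chi N g z \<noteq> 0" unfolding chi by (rule prod_nz)
  ultimately have "z * (deriv (chi N g) z / chi N g z) = z * S" by simp
  then have "z * (deriv (chi N g) z / chi N g z) = (\<Sum>i<N. - (z * \<theta> i * (1 / (1 - z * \<theta> i))))"
    by (simp add: S_def sum_distrib_left)
  moreover have "(\<lambda>n. \<Sum>i<N. - (z * \<theta> i * (z * \<theta> i) ^ n)) sums
      (\<Sum>i<N. - (z * \<theta> i * (1 / (1 - z * \<theta> i))))"
    using lt by (intro sums_sum sums_minus sums_mult geometric_sums) auto
  moreover have "(\<Sum>i<N. - (z * \<theta> i * (z * \<theta> i) ^ n)) = - (z ^ Suc n * mat_trace (h ^\<^sub>m Suc n))" for n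
    unfolding \<theta>(3) by (simp add: sum_distrib_left sum_negf power_mult_distrib mult_ac)
  ultimately show ?thesis by simp
qed

section \<open>Infinitesimal invariance of Haar measure\<close>

locale haar_unitary =
  fixes N :: nat and \<mu> :: "complex mat measure"
  assumes haar: "normalized_haar N \<mu>"
begin

abbreviation U :: "complex mat set" where "U \<equiv> carrier (unitary_group N)"

sublocale prob_space \<mu>
  using haar by (simp add: normalized_haar_def)

lemma sets_haar: "sets \<mu> = sets (unitary_borel N)"
  using haar by (simp add: normalized_haar_def)

lemma space_haar: "space \<mu> = U"
  using sets_eq_imp_space_eq[OF sets_haar] by (simp add: unitary_borel_def)

lemma U_carrier: "g \<in> U \<Longrightarrow> g \<in> carrier_mat N N"
  by (simp add: unitary_group_def)

lemma U_mult: "h \<in> U \<Longrightarrow> g \<in> U \<Longrightarrow> h * g \<in> U"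
  using monoid.m_closed[OF group.is_monoid[OF group_unitary_group], of h N g]
  by (simp add: unitary_group_def)

section \<open>Measurability and invariance under translation\<close>

lemma borel_measurable_entry [measurable]:
  assumes "i < N" "j < N"
  shows "(\<lambda>g. g $$ (i, j)) \<in> borel_measurable \<mu>"
proof -
  let ?M = "\<Pi>\<^sub>M ij\<in>{..<N} \<times> {..<N}. (borel :: complex measure)"
  let ?f = "\<lambda>g :: complex mat. \<lambda>(i, j)\<in>{..<N} \<times> {..<N}. g $$ (i, j)"
  have "?f \<in> measurable (unitary_borel N) ?M"
    unfolding unitary_borel_def by (rule measurable_vimage_algebra1) (auto simp: space_PiM)
  from measurable_compose[OF this measurable_component_singleton[of "(i, j)"]] assms
  have "(\<lambda>g. ?f g (i, j)) \<in> borel_measurable (unitary_borel N)" by simp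
  then show ?thesis
    using assms by (subst measurable_cong_sets[OF sets_haar refl]) simp
qed

lemma measurable_translate:
  assumes h: "h \<in> U"
  shows "(\<lambda>g. h * g) \<in> measurable \<mu> \<mu>"
proof -
  have "(\<lambda>g. h * g) \<in> measurable \<mu> (unitary_borel N)"
    unfolding unitary_borel_def
  proof (rule measurable_vimage_algebra2)
    show "(*) h \<in> space \<mu> \<rightarrow> U" using h by (auto simp: space_haar U_mult)
    have "(\<lambda>g. \<lambda>ij\<in>{..<N} \<times> {..<N}. (h * g) $$ ij) \<in> measurable \<mu> (\<Pi>\<^sub>M ij\<in>{..<N} \<times> {..<N}. borel)"
    proof (rule measurable_restrict)
      fix ij assume "ij \<in> {..<N} \<times> {..<N}"
      then obtain i j where ij: "ij = (i, j)" "i < N" "j < N" by auto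
      have "(\<lambda>g. \<Sum>k<N. h $$ (i, k) * g $$ (k, j)) \<in> borel_measurable \<mu>"
        using ij by measurable
      then show "(\<lambda>g. (h * g) $$ ij) \<in> borel_measurable \<mu>"
        using ij h index_mult_mat_sum[of h N N _ N i j]
        by (subst measurable_cong[where g = "\<lambda>g. \<Sum>k<N. h $$ (i, k) * g $$ (k, j)"])
          (auto simp: space_haar U_carrier simp del: index_mult_mat(1))
    qed
    then show "(\<lambda>g. \<lambda>(i, j)\<in>{..<N} \<times> {..<N}. (h * g) $$ (i, j))
        \<in> measurable \<mu> (\<Pi>\<^sub>M ij\<in>{..<N} \<times> {..<N}. borel)"
      by (simp add: case_prod_unfold)
  qed
  then show ?thesis using measurable_cong_sets[OF refl sets_haar] by blast
qed

lemma integral_translate: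
  fixes f :: "complex mat \<Rightarrow> complex"
  assumes h: "h \<in> U" and f: "f \<in> borel_measurable \<mu>"
  shows "(LINT g|\<mu>. f (h * g)) = (LINT g|\<mu>. f g)"
proof -
  have "distr \<mu> \<mu> (\<lambda>g. h * g) = \<mu>"
    using haar h by (simp add: normalized_haar_def unitary_group_def)
  then show ?thesis
    using integral_distr[OF measurable_translate[OF h] f] by simp
qed

text \<open>The bound is asked on \<open>U\<close> only, which is the whole space of
  \<open>\<mu>\<close>. Unlike integrability, this property is stable under products.\<close>

definition bounded_meas :: "(complex mat \<Rightarrow> complex) \<Rightarrow> bool" where
  "bounded_meas f \<longleftrightarrow> f \<in> borel_measurable \<mu> \<and> (\<exists>B. \<forall>g\<in>U. norm (f g) \<le> B)"

lemma bounded_meas_integrable: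
  assumes "bounded_meas f"
  shows "integrable \<mu> f"
proof -
  obtain B where "\<forall>g\<in>U. norm (f g) \<le> B" "f \<in> borel_measurable \<mu>"
    using assms by (auto simp: bounded_meas_def)
  then show ?thesis by (intro integrable_const_bound[of _ B]) (auto simp: space_haar)
qed

lemma bounded_measE:
  assumes "bounded_meas f"
  obtains B where "0 \<le> B" "\<And>g. g \<in> U \<Longrightarrow> norm (f g) \<le> B"
proof -
  obtain B where "\<forall>g\<in>U. norm (f g) \<le> B" using assms by (auto simp: bounded_meas_def)
  then have "norm (f g) \<le> \<bar>B\<bar>" if "g \<in> U" for g using that by fastforce
  then show thesis by (rule that[OF abs_ge_zero])
qed

lemma bounded_meas_const [intro]: "bounded_meas (\<lambda>g. c)"
  by (auto simp: bounded_meas_def)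

lemma bounded_meas_mult [intro]:
  assumes "bounded_meas f" "bounded_meas h"
  shows "bounded_meas (\<lambda>g. f g * h g)"
proof -
  obtain B where B: "0 \<le> B" "\<And>g. g \<in> U \<Longrightarrow> norm (f g) \<le> B"
    using bounded_measE[OF assms(1)] by blast
  obtain C where C: "0 \<le> C" "\<And>g. g \<in> U \<Longrightarrow> norm (h g) \<le> C"
    using bounded_measE[OF assms(2)] by blast
  have "norm (f g * h g) \<le> B * C" if "g \<in> U" for g
    using that B C by (simp add: norm_mult mult_mono)
  then show ?thesis using assms by (auto simp: bounded_meas_def)
qed

lemma bounded_meas_add [intro]:
  assumes "bounded_meas f" "bounded_meas h"
  shows "bounded_meas (\<lambda>g. f g + h g)"
proof -
  obtain B where B: "0 \<le> B" "\<And>g. g \<in> U \<Longrightarrow> norm (f g) \<le> B"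
    using bounded_measE[OF assms(1)] by blast
  obtain C where C: "0 \<le> C" "\<And>g. g \<in> U \<Longrightarrow> norm (h g) \<le> C"
    using bounded_measE[OF assms(2)] by blast
  have "norm (f g + h g) \<le> B + C" if "g \<in> U" for g
    using that norm_triangle_mono[OF B(2) C(2)] by simp
  then show ?thesis using assms by (auto simp: bounded_meas_def)
qed

lemma bounded_meas_sum [intro]:
  "(\<And>x. x \<in> A \<Longrightarrow> bounded_meas (f x)) \<Longrightarrow> bounded_meas (\<lambda>g. \<Sum>x\<in>A. f x g)"
  by (induction A rule: infinite_finite_induct) auto

lemma bounded_meas_cnj [intro]:
  assumes "bounded_meas f"
  shows "bounded_meas (\<lambda>g. cnj (f g))"
proof -
  have "cnj \<in> borel_measurable borel"
    by (intro borel_measurable_continuous_onI continuous_on_cnj continuous_on_id)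
  then show ?thesis
    using assms measurable_compose[of f \<mu> borel cnj borel] by (simp add: bounded_meas_def)
qed

lemma bounded_meas_uminus [intro]: "bounded_meas f \<Longrightarrow> bounded_meas (\<lambda>g. - f g)"
  by (auto simp: bounded_meas_def)

lemma bounded_meas_diff [intro]:
  "bounded_meas f \<Longrightarrow> bounded_meas h \<Longrightarrow> bounded_meas (\<lambda>g. f g - h g)"
  using bounded_meas_add[of f "\<lambda>g. - h g"] bounded_meas_uminus[of h] by simp

lemma bounded_meas_cong:
  "(\<And>g. g \<in> U \<Longrightarrow> f g = h g) \<Longrightarrow> bounded_meas f \<longleftrightarrow> bounded_meas h"
  unfolding bounded_meas_def using measurable_cong[of \<mu> f h borel] by (auto simp: space_haar)

lemma bounded_meas_entry [intro]:
  "i < N \<Longrightarrow> j < N \<Longrightarrow> bounded_meas (\<lambda>g. g $$ (i, j))"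
  unfolding bounded_meas_def using norm_unitary_entry_le by (blast intro: borel_measurable_entry)

lemma bounded_meas_translate:
  assumes h: "h \<in> U" and f: "bounded_meas f"
  shows "bounded_meas (\<lambda>g. f (h * g))"
  using f measurable_compose[OF measurable_translate[OF h]] U_mult[OF h]
  unfolding bounded_meas_def by blast

lemma integral_norm_bound_U:
  assumes "bounded_meas f" "\<And>g. g \<in> U \<Longrightarrow> norm (f g) \<le> B"
  shows "norm (LINT g|\<mu>. f g) \<le> B"
proof -
  have "norm (LINT g|\<mu>. f g) \<le> (LINT g|\<mu>. norm (f g))" by (rule integral_norm_bound)
  also have "\<dots> \<le> (LINT g|\<mu>. B)"
    using assms by (intro integral_mono integrable_norm bounded_meas_integrable)
      (auto simp: space_haar)
  finally show ?thesis using prob_space by simp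
qed

text \<open>The one-parameter group \<open>1 + (e\<^sup>i\<^sup>t - 1) w w\<^sup>*\<close> generated by the projection onto a unit vector
  \<open>w\<close>. These projections span all matrices, so they give the infinitesimal invariance of \<open>\<mu>\<close> in
  every direction without the matrix exponential.\<close>

definition unit_vector :: "(nat \<Rightarrow> complex) \<Rightarrow> bool" where
  "unit_vector w \<longleftrightarrow> (\<Sum>i<N. w i * cnj (w i)) = 1"

definition rotation :: "(nat \<Rightarrow> complex) \<Rightarrow> real \<Rightarrow> complex mat" where
  "rotation w t = mat N N (\<lambda>(i, j). (if i = j then 1 else 0) + (cis t - 1) * w i * cnj (w j))"

lemma rotation_carrier [simp]: "rotation w t \<in> carrier_mat N N"
  by (simp add: rotation_def)

lemma rotation_mult_index:
  assumes g: "g \<in> carrier_mat N N" and ij: "i < N" "j < N"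
  shows "(rotation w t * g) $$ (i, j) =
    g $$ (i, j) + (cis t - 1) * w i * (\<Sum>k<N. cnj (w k) * g $$ (k, j))"
proof -
  have "(rotation w t * g) $$ (i, j) = (\<Sum>k<N. (if i = k then g $$ (k, j) else 0)
      + (cis t - 1) * w i * (cnj (w k) * g $$ (k, j)))"
    unfolding index_mult_mat_sum[OF rotation_carrier g ij]
    using ij by (intro sum.cong) (auto simp: rotation_def algebra_simps)
  then show ?thesis
    using ij by (simp add: sum.distrib sum_distrib_left)
qed

text \<open>With \<open>c = cis t - 1\<close> and P the projection onto \<open>w\<close>, the
  product of 1 + c P and its adjoint is 1 + (c + cnj c + c cnj c) P since P is idempotent, and the
  bracket vanishes because \<open>cis t\<close> has modulus 1.\<close>

lemma rotation_unitary:
  assumes w: "unit_vector w"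
  shows "rotation w t \<in> U"
proof -
  define c where "c = cis t - 1"
  have c: "c + cnj c + c * cnj c = 0"
    by (simp add: c_def algebra_simps cis_cnj cis_mult)
  have adj: "mat_adjoint (rotation w t) \<in> carrier_mat N N"
    by (rule mat_adjoint_carrier) simp
  have "rotation w t * mat_adjoint (rotation w t) = 1\<^sub>m N"
  proof (rule eq_matI)
    fix i j assume "i < dim_row (1\<^sub>m N :: complex mat)" "j < dim_col (1\<^sub>m N :: complex mat)"
    then have ij: "i < N" "j < N" by auto
    have e: "mat_adjoint (rotation w t) $$ (k, j) =
        (if j = k then 1 else 0) + cnj c * cnj (w j) * w k" if "k < N" for k
      using that ij by (simp add: mat_adjoint_index[OF rotation_carrier]) (simp add: rotation_def c_def)
    have "(\<Sum>k<N. cnj (w k) * mat_adjoint (rotation w t) $$ (k, j)) =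
        (\<Sum>k<N. (if j = k then cnj (w k) else 0) + cnj c * cnj (w j) * (w k * cnj (w k)))"
      by (intro sum.cong) (auto simp: e algebra_simps)
    also have "\<dots> = cnj (w j) + cnj c * cnj (w j)"
      using w ij by (simp add: sum.distrib sum_distrib_left[symmetric] unit_vector_def)
    finally have "(rotation w t * mat_adjoint (rotation w t)) $$ (i, j) =
        (if i = j then 1 else 0) + (c + cnj c + c * cnj c) * w i * cnj (w j)"
      unfolding rotation_mult_index[OF adj ij] c_def[symmetric]
      using e[OF ij(1)] ij by (auto simp: algebra_simps)
    then show "(rotation w t * mat_adjoint (rotation w t)) $$ (i, j) = 1\<^sub>m N $$ (i, j)"
      using ij c by simp
  qed (use adj in \<open>auto simp: rotation_def\<close>)
  then show ?thesis by (simp add: unitary_group_def)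
qed

text \<open>The remainder is uniform in \<open>g\<close>, so the expansion survives integration over
  the group. The factor \<open>\<i>\<close> is the derivative of \<open>cis\<close> at 0, kept apart
  so that \<open>f'\<close> is the derivative in the direction of the projection itself.\<close>

definition expands_along ::
  "(nat \<Rightarrow> complex) \<Rightarrow> (complex mat \<Rightarrow> complex) \<Rightarrow> (complex mat \<Rightarrow> complex) \<Rightarrow> bool" where
  "expands_along w f f' \<longleftrightarrow>
     (\<exists>C. \<forall>g\<in>U. \<forall>t\<in>{-1..1}. norm (f (rotation w t * g) - f g - \<i> * t * f' g) \<le> C * t\<^sup>2)"

text \<open>The entries of the projection onto \<open>w\<close> are \<open>w u * cnj (w v)\<close>,
  so this pairs it with the gradient \<open>G\<close>. As a quadratic form in \<open>w\<close> it
  can be polarized.\<close>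

definition dir :: "(nat \<Rightarrow> complex) \<Rightarrow> (nat \<Rightarrow> nat \<Rightarrow> complex mat \<Rightarrow> complex) \<Rightarrow> complex mat \<Rightarrow> complex" where
  "dir w G g = (\<Sum>u<N. \<Sum>v<N. w u * cnj (w v) * G u v g)"

text \<open>\<open>G u v\<close> is the derivative of \<open>f\<close> at \<open>g\<close> in the complexified direction \<open>X g\<close>, where \<open>X\<close> is the
  matrix unit at \<open>(u, v)\<close>; anti-holomorphic functions are differentiated accordingly.\<close>

definition has_grad :: "(complex mat \<Rightarrow> complex) \<Rightarrow> (nat \<Rightarrow> nat \<Rightarrow> complex mat \<Rightarrow> complex) \<Rightarrow> bool" where
  "has_grad f G \<longleftrightarrow> bounded_meas f \<and> (\<forall>u<N. \<forall>v<N. bounded_meas (G u v)) \<and>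
     (\<forall>w. unit_vector w \<longrightarrow> expands_along w f (dir w G))"

lemma has_gradD:
  assumes "has_grad f G"
  shows "bounded_meas f" "u < N \<Longrightarrow> v < N \<Longrightarrow> bounded_meas (G u v)"
    "unit_vector w \<Longrightarrow> expands_along w f (dir w G)"
  using assms by (auto simp: has_grad_def)

lemma bounded_meas_dir: "has_grad f G \<Longrightarrow> bounded_meas (dir w G)"
  unfolding dir_def[abs_def] by (intro bounded_meas_sum bounded_meas_mult) (auto dest: has_gradD)

lemma has_grad_cong:
  assumes "has_grad f G" "\<And>g. g \<in> U \<Longrightarrow> f g = f2 g"
    "\<And>u v g. u < N \<Longrightarrow> v < N \<Longrightarrow> g \<in> U \<Longrightarrow> G u v g = G2 u v g"
  shows "has_grad f2 G2"
proof -
  have "dir w G g = dir w G2 g" if "g \<in> U" for w g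
    using assms(3) that by (simp add: dir_def)
  then have "expands_along w f (dir w G) \<longleftrightarrow> expands_along w f2 (dir w G2)" if "unit_vector w" for w
    unfolding expands_along_def
    using U_mult[OF rotation_unitary[OF that]] assms(2) by simp
  then show ?thesis
    using assms(1) bounded_meas_cong[of f f2] bounded_meas_cong[of "G u v" "G2 u v" for u v] assms(2,3)
    by (simp add: has_grad_def)
qed

lemma has_grad_const: "has_grad (\<lambda>g. c) (\<lambda>u v g. 0)"
  by (auto simp: has_grad_def expands_along_def dir_def intro!: exI[of _ 0])

lemma norm_cis_minus_linear_le:
  assumes "\<bar>t\<bar> \<le> 1"
  shows "norm (cis t - 1 - \<i> * t) \<le> t\<^sup>2"
proof -
  have "norm (exp (\<i> * complex_of_real t) - (\<Sum>i\<le>1. (\<i> * complex_of_real t) ^ i / fact i))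
      \<le> exp \<bar>Re (\<i> * complex_of_real t)\<bar> * norm (\<i> * complex_of_real t) ^ Suc 1 / fact 1"
    by (rule Taylor_exp)
  then show ?thesis by (simp add: cis_conv_exp norm_mult power2_eq_square diff_diff_eq)
qed

text \<open>Multiplication from the left by the matrix unit at \<open>(u, v)\<close> moves row
  \<open>v\<close> of \<open>g\<close> into row \<open>u\<close>.\<close>

lemma has_grad_entry:
  assumes ij: "i < N" "j < N"
  shows "has_grad (\<lambda>g. g $$ (i, j)) (\<lambda>u v g. if u = i then g $$ (v, j) else 0)"
  unfolding has_grad_def
proof (intro conjI allI impI)
  show "bounded_meas (\<lambda>g. g $$ (i, j))" using ij by auto
  show "bounded_meas (\<lambda>g. if u = i then g $$ (v, j) else 0)" if "v < N" for u v
    using that ij by (cases "u = i") auto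
  fix w assume w: "unit_vector w"
  let ?S = "\<lambda>g :: complex mat. \<Sum>k<N. cnj (w k) * g $$ (k, j)"
  have "bounded_meas (\<lambda>g. w i * ?S g)"
    using ij by (intro bounded_meas_mult bounded_meas_sum bounded_meas_const bounded_meas_entry) auto
  then obtain B where B: "0 \<le> B" "\<And>g. g \<in> U \<Longrightarrow> norm (w i * ?S g) \<le> B"
    by (rule bounded_measE) blast
  show "expands_along w (\<lambda>g. g $$ (i, j)) (dir w (\<lambda>u v g. if u = i then g $$ (v, j) else 0))"
    unfolding expands_along_def
  proof (intro exI ballI)
    fix g t assume g: "g \<in> U" and t: "t \<in> {-1..1::real}"
    have "dir w (\<lambda>u v g. if u = i then g $$ (v, j) else 0) g =
        (\<Sum>u<N. if u = i then w i * ?S g else 0)"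
      unfolding dir_def by (intro sum.cong) (auto simp: sum_distrib_left mult_ac)
    also have "\<dots> = w i * ?S g" using ij by simp
    \<comment> \<open>The rotation is affine in \<open>cis t\<close>, so the remainder is exactly
      that of \<open>cis\<close> times a bounded factor.\<close>
    finally have "(rotation w t * g) $$ (i, j) - g $$ (i, j) - \<i> * t *
        dir w (\<lambda>u v g. if u = i then g $$ (v, j) else 0) g = (cis t - 1 - \<i> * t) * (w i * ?S g)"
      unfolding rotation_mult_index[OF U_carrier[OF g] ij] by (simp add: algebra_simps)
    also have "norm \<dots> \<le> t\<^sup>2 * B"
      unfolding norm_mult[of "cis t - 1 - \<i> * t"]
      using t by (intro mult_mono norm_cis_minus_linear_le B(2)[OF g]) auto
    finally show "norm ((rotation w t * g) $$ (i, j) - g $$ (i, j) - \<i> * t *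
        dir w (\<lambda>u v g. if u = i then g $$ (v, j) else 0) g) \<le> B * t\<^sup>2"
      by (simp add: mult.commute)
  qed
qed

lemma expands_alongE:
  assumes "expands_along w f f'"
  obtains C where "0 \<le> C"
    "\<And>g t. g \<in> U \<Longrightarrow> t \<in> {-1..1} \<Longrightarrow> norm (f (rotation w t * g) - f g - \<i> * t * f' g) \<le> C * t\<^sup>2"
proof -
  obtain C where C: "\<forall>g\<in>U. \<forall>t\<in>{-1..1}. norm (f (rotation w t * g) - f g - \<i> * t * f' g) \<le> C * t\<^sup>2"
    using assms by (auto simp: expands_along_def)
  have *: "C * t\<^sup>2 \<le> \<bar>C\<bar> * t\<^sup>2" for t :: real by (intro mult_right_mono) auto
  show thesis
  proof (rule that[OF abs_ge_zero])
    fix g t assume "g \<in> U" "t \<in> {-1..1::real}"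
    then show "norm (f (rotation w t * g) - f g - \<i> * t * f' g) \<le> \<bar>C\<bar> * t\<^sup>2"
      using C * by (blast intro: order_trans)
  qed
qed

lemma has_grad_add:
  assumes "has_grad f F" "has_grad h H"
  shows "has_grad (\<lambda>g. f g + h g) (\<lambda>u v g. F u v g + H u v g)"
  unfolding has_grad_def
proof (intro conjI allI impI)
  fix w assume w: "unit_vector w"
  obtain C where C: "0 \<le> C" "\<And>g t. g \<in> U \<Longrightarrow> t \<in> {-1..1} \<Longrightarrow>
      norm (f (rotation w t * g) - f g - \<i> * t * dir w F g) \<le> C * t\<^sup>2"
    using expands_alongE[OF has_gradD(3)[OF assms(1) w]] by blast
  obtain D where D: "0 \<le> D" "\<And>g t. g \<in> U \<Longrightarrow> t \<in> {-1..1} \<Longrightarrow>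
      norm (h (rotation w t * g) - h g - \<i> * t * dir w H g) \<le> D * t\<^sup>2"
    using expands_alongE[OF has_gradD(3)[OF assms(2) w]] by blast
  have d: "dir w (\<lambda>u v g. F u v g + H u v g) g = dir w F g + dir w H g" for g
    by (simp add: dir_def sum.distrib algebra_simps)
  show "expands_along w (\<lambda>g. f g + h g) (dir w (\<lambda>u v g. F u v g + H u v g))"
    unfolding expands_along_def
  proof (intro exI[of _ "C + D"] ballI)
    fix g t assume g: "g \<in> U" and t: "t \<in> {-1..1::real}"
    have "norm ((f (rotation w t * g) - f g - \<i> * t * dir w F g)
        + (h (rotation w t * g) - h g - \<i> * t * dir w H g)) \<le> C * t\<^sup>2 + D * t\<^sup>2"
      using C(2)[OF g t] D(2)[OF g t] by (rule norm_triangle_mono)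
    then show "norm (f (rotation w t * g) + h (rotation w t * g) - (f g + h g) -
        \<i> * t * dir w (\<lambda>u v g. F u v g + H u v g) g) \<le> (C + D) * t\<^sup>2"
      unfolding d by (simp add: algebra_simps)
  qed
qed (use assms in \<open>auto simp: has_grad_def\<close>)

lemma has_grad_sum:
  assumes "finite A" "\<And>x. x \<in> A \<Longrightarrow> has_grad (f x) (F x)"
  shows "has_grad (\<lambda>g. \<Sum>x\<in>A. f x g) (\<lambda>u v g. \<Sum>x\<in>A. F x u v g)"
  using assms by (induction A rule: finite_induct) (simp_all add: has_grad_const has_grad_add)

text \<open>Conjugation turns the factor \<open>\<i>\<close> into \<open>- \<i>\<close>, hence the
  sign, and transposes the entries of the projection, hence the swapped indices.\<close>

lemma has_grad_cnj:
  assumes "has_grad f F"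
  shows "has_grad (\<lambda>g. cnj (f g)) (\<lambda>u v g. - cnj (F v u g))"
  unfolding has_grad_def
proof (intro conjI allI impI)
  fix w assume w: "unit_vector w"
  obtain C where C: "0 \<le> C" "\<And>g t. g \<in> U \<Longrightarrow> t \<in> {-1..1} \<Longrightarrow>
      norm (f (rotation w t * g) - f g - \<i> * t * dir w F g) \<le> C * t\<^sup>2"
    using expands_alongE[OF has_gradD(3)[OF assms w]] by blast
  have d: "dir w (\<lambda>u v g. - cnj (F v u g)) g = - cnj (dir w F g)" for g
    unfolding dir_def by (subst sum.swap) (simp add: sum_negf mult_ac)
  show "expands_along w (\<lambda>g. cnj (f g)) (dir w (\<lambda>u v g. - cnj (F v u g)))"
    unfolding expands_along_def
  proof (intro exI[of _ C] ballI)
    fix g t assume g: "g \<in> U" and t: "t \<in> {-1..1::real}"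
    have "norm (cnj (f (rotation w t * g) - f g - \<i> * t * dir w F g)) \<le> C * t\<^sup>2"
      unfolding complex_mod_cnj by (rule C(2)[OF g t])
    then show "norm (cnj (f (rotation w t * g)) - cnj (f g) -
        \<i> * t * dir w (\<lambda>u v g. - cnj (F v u g)) g) \<le> C * t\<^sup>2"
      unfolding d by simp
  qed
qed (auto intro!: bounded_meas_uminus bounded_meas_cnj has_gradD[OF assms])

lemma has_grad_mult:
  assumes "has_grad f F" "has_grad h H"
  shows "has_grad (\<lambda>g. f g * h g) (\<lambda>u v g. f g * H u v g + F u v g * h g)"
  unfolding has_grad_def
proof (intro conjI allI impI)
  fix w assume w: "unit_vector w"
  obtain C where C: "0 \<le> C" "\<And>g t. g \<in> U \<Longrightarrow> t \<in> {-1..1} \<Longrightarrow>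
      norm (f (rotation w t * g) - f g - \<i> * t * dir w F g) \<le> C * t\<^sup>2"
    using expands_alongE[OF has_gradD(3)[OF assms(1) w]] by blast
  obtain D where D: "0 \<le> D" "\<And>g t. g \<in> U \<Longrightarrow> t \<in> {-1..1} \<Longrightarrow>
      norm (h (rotation w t * g) - h g - \<i> * t * dir w H g) \<le> D * t\<^sup>2"
    using expands_alongE[OF has_gradD(3)[OF assms(2) w]] by blast
  obtain A where A: "0 \<le> A" "\<And>g. g \<in> U \<Longrightarrow> norm (f g) \<le> A"
    using bounded_measE[OF has_gradD(1)[OF assms(1)]] by blast
  obtain B where B: "0 \<le> B" "\<And>g. g \<in> U \<Longrightarrow> norm (h g) \<le> B"
    using bounded_measE[OF has_gradD(1)[OF assms(2)]] by blast
  obtain A' where A': "0 \<le> A'" "\<And>g. g \<in> U \<Longrightarrow> norm (dir w F g) \<le> A'"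
    using bounded_measE[OF bounded_meas_dir[OF assms(1)]] by blast
  obtain B' where B': "0 \<le> B'" "\<And>g. g \<in> U \<Longrightarrow> norm (dir w H g) \<le> B'"
    using bounded_measE[OF bounded_meas_dir[OF assms(2)]] by blast
  have d: "dir w (\<lambda>u v g. f g * H u v g + F u v g * h g) g = f g * dir w H g + dir w F g * h g" for g
    by (simp add: dir_def sum.distrib sum_distrib_left sum_distrib_right algebra_simps)
  show "expands_along w (\<lambda>g. f g * h g) (dir w (\<lambda>u v g. f g * H u v g + F u v g * h g))"
    unfolding expands_along_def
  proof (intro exI[of _ "C * B + (A + A') * D + A' * B'"] ballI)
    fix g t assume g: "g \<in> U" and t: "t \<in> {-1..1::real}"
    let ?g = "rotation w t * g"
    have g': "?g \<in> U" by (rule U_mult[OF rotation_unitary[OF w] g])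
    define R where "R = f ?g - f g - \<i> * t * dir w F g"
    define S where "S = h ?g - h g - \<i> * t * dir w H g"
    have "norm (R * h ?g) \<le> (C * t\<^sup>2) * B"
      unfolding norm_mult R_def using C(1) by (intro mult_mono C(2) B(2) g t g') auto
    moreover have "norm (f g + \<i> * t * dir w F g) \<le> A + A'"
    proof (rule norm_triangle_mono[OF A(2)[OF g]])
      have "norm (\<i> * t * dir w F g) \<le> 1 * A'"
        unfolding norm_mult using t by (intro mult_mono A'(2) g) auto
      then show "norm (\<i> * t * dir w F g) \<le> A'" by simp
    qed
    then have "norm ((f g + \<i> * t * dir w F g) * S) \<le> (A + A') * (D * t\<^sup>2)"
      unfolding norm_mult S_def using A(1) A'(1) by (intro mult_mono D(2) g t) auto
    moreover have "norm ((\<i> * t)\<^sup>2 * (dir w F g * dir w H g)) \<le> t\<^sup>2 * (A' * B')"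
      unfolding norm_mult norm_power using A' by (intro mult_mono A'(2) B'(2) g) auto
    \<comment> \<open>The error of the product telescopes: the remainder of \<open>f\<close> meets
      the full value of \<open>h\<close>, the first-order part of \<open>f\<close> meets the
      remainder of \<open>h\<close>, and the product of the two linear terms is already quadratic in
      \<open>t\<close>.\<close>
    ultimately have "norm (R * h ?g + (f g + \<i> * t * dir w F g) * S + (\<i> * t)\<^sup>2 * (dir w F g * dir w H g))
        \<le> (C * t\<^sup>2) * B + (A + A') * (D * t\<^sup>2) + t\<^sup>2 * (A' * B')"
      by (intro norm_triangle_mono)
    also have "R * h ?g + (f g + \<i> * t * dir w F g) * S + (\<i> * t)\<^sup>2 * (dir w F g * dir w H g) =
        f ?g * h ?g - f g * h g - \<i> * t * (f g * dir w H g + dir w F g * h g)"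
      unfolding R_def S_def by (simp add: algebra_simps power2_eq_square)
    also have "(C * t\<^sup>2) * B + (A + A') * (D * t\<^sup>2) + t\<^sup>2 * (A' * B') =
        (C * B + (A + A') * D + A' * B') * t\<^sup>2"
      by (simp add: algebra_simps)
    finally show "norm (f ?g * h ?g - f g * h g -
        \<i> * t * dir w (\<lambda>u v g. f g * H u v g + F u v g * h g) g)
        \<le> (C * B + (A + A') * D + A' * B') * t\<^sup>2"
      unfolding d .
  qed
qed (auto intro!: bounded_meas_add bounded_meas_mult has_gradD[OF assms(1)] has_gradD[OF assms(2)])

text \<open>By invariance the increment of \<open>f\<close> integrates to zero, so \<open>t\<close>
  times the integral of the derivative is at most \<open>C\<close> times the square of
  \<open>t\<close>. Dividing by \<open>t\<close> and shrinking it leaves zero.\<close>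

lemma integral_dir_eq_0:
  assumes f: "has_grad f G" and w: "unit_vector w"
  shows "(LINT g|\<mu>. dir w G g) = 0"
proof -
  obtain C where C: "0 \<le> C" "\<And>g t. g \<in> U \<Longrightarrow> t \<in> {-1..1} \<Longrightarrow>
      norm (f (rotation w t * g) - f g - \<i> * t * dir w G g) \<le> C * t\<^sup>2"
    using expands_alongE[OF has_gradD(3)[OF f w]] by blast
  let ?I = "LINT g|\<mu>. dir w G g"
  note bm = has_gradD(1)[OF f] bounded_meas_dir[OF f, of w]
    bounded_meas_translate[OF rotation_unitary[OF w] has_gradD(1)[OF f]]
  have le: "norm ?I \<le> C * t" if t: "0 < t" "t \<le> 1" for t
  proof -
    let ?R = "\<lambda>g. f (rotation w t * g) - f g - \<i> * t * dir w G g"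
    have "bounded_meas ?R" using bm by (intro bounded_meas_diff bounded_meas_mult) auto
    then have "norm (LINT g|\<mu>. ?R g) \<le> C * t\<^sup>2"
      using C(2) t by (intro integral_norm_bound_U) auto
    moreover have "(LINT g|\<mu>. ?R g) = - (\<i> * t * ?I)"
      using bm integral_translate[OF rotation_unitary[OF w], of f t]
      by (simp add: bounded_meas_integrable bounded_meas_def[of f])
    ultimately have "t * norm ?I \<le> t * (C * t)"
      using t by (simp add: norm_mult power2_eq_square mult_ac)
    then show ?thesis using t by simp
  qed
  have "norm ?I \<le> 0"
  proof (rule field_le_epsilon)
    fix e :: real assume e: "0 < e"
    \<comment> \<open>\<open>C + 1\<close> keeps \<open>t\<close> positive when \<open>C\<close> is
      0; the minimum keeps it in the range of the expansion.\<close>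
    define t where "t = min 1 (e / (C + 1))"
    have "C * t \<le> C * (e / (C + 1))" using C(1) by (intro mult_left_mono) (auto simp: t_def)
    also have "\<dots> \<le> e" using C(1) e by (simp add: field_simps)
    finally show "norm ?I \<le> 0 + e"
      using le[of t] C(1) e by (simp add: t_def)
  qed
  then show ?thesis by simp
qed

text \<open>Polarization: the quadratic form \<open>\<Sum> w\<^sub>u w\<^sub>v\<^sup>* \<integral>G\<^sub>u\<^sub>v\<close> vanishes on unit vectors.\<close>

lemma integral_grad_eq_0:
  assumes f: "has_grad f G" and uv: "u < N" "v < N"
  shows "(LINT g|\<mu>. G u v g) = 0"
proof -
  define \<phi> where "\<phi> u v = (LINT g|\<mu>. G u v g)" for u v
  have q: "(\<Sum>u<N. \<Sum>v<N. w u * cnj (w v) * \<phi> u v) = 0" if "unit_vector w" for w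
  proof -
    have int: "integrable \<mu> (\<lambda>g. w u * cnj (w v) * G u v g)" if "u < N" "v < N" for u v
      using has_gradD(2)[OF f that] by (intro bounded_meas_integrable) auto
    have "(LINT g|\<mu>. dir w G g) = (\<Sum>u<N. (LINT g|\<mu>. (\<Sum>v<N. w u * cnj (w v) * G u v g)))"
      unfolding dir_def
      by (intro Bochner_Integration.integral_sum Bochner_Integration.integrable_sum int) auto
    also have "\<dots> = (\<Sum>u<N. \<Sum>v<N. (LINT g|\<mu>. w u * cnj (w v) * G u v g))"
      by (intro sum.cong refl Bochner_Integration.integral_sum int) auto
    finally have "(LINT g|\<mu>. dir w G g) = (\<Sum>u<N. \<Sum>v<N. (LINT g|\<mu>. w u * cnj (w v) * G u v g))" .
    then show ?thesis using integral_dir_eq_0[OF f that] by (simp add: \<phi>_def)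
  qed
  have diag: "\<phi> u u = 0" if u: "u < N" for u
  proof -
    define w where "w k = (if k = u then 1 else 0 :: complex)" for k
    have red: "(\<Sum>k<N. h k) = h u" if "\<And>k. k \<noteq> u \<Longrightarrow> h k = 0" for h :: "nat \<Rightarrow> complex"
    proof -
      have "(\<Sum>k<N. h k) = (\<Sum>k\<in>{u}. h k)"
        using u that by (intro sum.mono_neutral_right) auto
      then show ?thesis by simp
    qed
    have "(\<Sum>k<N. w k * cnj (w k)) = w u * cnj (w u)" by (rule red) (simp add: w_def)
    then have unit: "unit_vector w" by (simp add: unit_vector_def w_def)
    have inner: "(\<Sum>l<N. w k * cnj (w l) * \<phi> k l) = w k * cnj (w u) * \<phi> k u" for k
      by (rule red) (simp add: w_def)
    have "0 = (\<Sum>k<N. \<Sum>l<N. w k * cnj (w l) * \<phi> k l)" by (rule q[OF unit, symmetric])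
    also have "\<dots> = w u * cnj (w u) * \<phi> u u" unfolding inner by (rule red) (simp add: w_def)
    finally show ?thesis by (simp add: w_def)
  qed
  show ?thesis
  proof (cases "u = v")
    case True
    then show ?thesis using diag uv by (simp add: \<phi>_def)
  next
    case False
    define c where "c = complex_of_real (1 / sqrt 2)"
    have c: "c * cnj c = 1 / 2" "cnj c = c" "c * c = 1 / 2"
      by (simp_all add: c_def flip: of_real_mult)
    have pol: "cnj \<omega> * \<phi> u v + \<omega> * \<phi> v u = 0" if \<omega>: "\<omega> * cnj \<omega> = 1" for \<omega>
    proof -
      \<comment> \<open>A combination of two basis vectors with relative phase
        \<open>\<omega>\<close>, normalized by \<open>c\<close>. As the diagonal entries vanish,
        only the two off-diagonal ones remain.\<close>
      define w where "w k = (if k = u then c else if k = v then c * \<omega> else 0)" for k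
      have red: "(\<Sum>k<N. h k) = h u + h v" if "\<And>k. k \<noteq> u \<Longrightarrow> k \<noteq> v \<Longrightarrow> h k = 0" for h :: "nat \<Rightarrow> complex"
      proof -
        have "(\<Sum>k<N. h k) = (\<Sum>k\<in>{u, v}. h k)"
          using uv that by (intro sum.mono_neutral_right) auto
        then show ?thesis using False by simp
      qed
      have wu: "w u = c" "w v = c * \<omega>" using False by (auto simp: w_def)
      have w0: "w k = 0" if "k \<noteq> u" "k \<noteq> v" for k using that by (simp add: w_def)
      have "(\<Sum>k<N. w k * cnj (w k)) = w u * cnj (w u) + w v * cnj (w v)"
        by (rule red) (simp add: w0)
      also have "\<dots> = c * cnj c + c * cnj c * (\<omega> * cnj \<omega>)"
        by (simp add: wu)
      finally have "(\<Sum>k<N. w k * cnj (w k)) = c * cnj c + c * cnj c * (\<omega> * cnj \<omega>)" .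
      then have unit: "unit_vector w" using \<omega> c by (simp add: unit_vector_def)
      have inner: "(\<Sum>l<N. w k * cnj (w l) * \<phi> k l) =
          w k * cnj (w u) * \<phi> k u + w k * cnj (w v) * \<phi> k v" for k
        by (rule red) (simp add: w0)
      have "0 = (\<Sum>k<N. \<Sum>l<N. w k * cnj (w l) * \<phi> k l)"
        by (rule q[OF unit, symmetric])
      also have "\<dots> = w u * cnj (w u) * \<phi> u u + w u * cnj (w v) * \<phi> u v
          + (w v * cnj (w u) * \<phi> v u + w v * cnj (w v) * \<phi> v v)"
        unfolding inner by (rule red) (simp add: w0)
      also have "\<dots> = c * c * (cnj \<omega> * \<phi> u v + \<omega> * \<phi> v u)"
        using diag uv by (simp add: wu c(2) algebra_simps)
      finally show ?thesis using c by simp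
    qed
    \<comment> \<open>The phase 1 gives the sum of the two entries and the phase \<open>\<i>\<close>
      their difference.\<close>
    have "\<phi> u v + \<phi> v u = 0" "\<phi> v u = \<phi> u v"
      using pol[of 1] pol[of \<i>] by simp_all
    then show ?thesis unfolding \<phi>_def by simp
  qed
qed

end

section \<open>The Gaussian covariance of power sums\<close>

lemma z_part_eq_prod:
  assumes "finite A" "set_mset \<nu> \<subseteq> A"
  shows "z_part \<nu> = (\<Prod>i\<in>A. i ^ count \<nu> i * fact (count \<nu> i))"
  unfolding z_part_def using assms
  by (intro prod.mono_neutral_left) (auto simp: not_in_iff)

lemma z_part_add_mset: "z_part (add_mset a \<nu>) = a * Suc (count \<nu> a) * z_part \<nu>"
proof -
  let ?A = "insert a (set_mset \<nu>)"
  let ?z = "\<lambda>\<nu> i. i ^ count \<nu> i * fact (count \<nu> i) :: nat"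
  have "z_part (add_mset a \<nu>) = (\<Prod>i\<in>?A. ?z (add_mset a \<nu>) i)"
    by (rule z_part_eq_prod) auto
  also have "\<dots> = ?z (add_mset a \<nu>) a * (\<Prod>i\<in>?A - {a}. ?z (add_mset a \<nu>) i)"
    by (rule prod.remove) auto
  also have "(\<Prod>i\<in>?A - {a}. ?z (add_mset a \<nu>) i) = (\<Prod>i\<in>?A - {a}. ?z \<nu> i)"
    by (intro prod.cong) auto
  also have "?z (add_mset a \<nu>) a = a * Suc (count \<nu> a) * ?z \<nu> a"
    by (simp add: algebra_simps)
  finally have "z_part (add_mset a \<nu>) =
      a * Suc (count \<nu> a) * (?z \<nu> a * (\<Prod>i\<in>?A - {a}. ?z \<nu> i))"
    by (simp only: mult.assoc)
  also have "?z \<nu> a * (\<Prod>i\<in>?A - {a}. ?z \<nu> i) = (\<Prod>i\<in>?A. ?z \<nu> i)"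
    by (rule prod.remove[symmetric]) auto
  also have "\<dots> = z_part \<nu>"
    by (rule z_part_eq_prod[symmetric]) auto
  finally show ?thesis .
qed

lemma z_part_le: "z_part \<nu> \<le> sum_mset \<nu> ^ size \<nu> * fact (size \<nu>)"
proof (induction \<nu>)
  case empty
  then show ?case by (simp add: z_part_def)
next
  case (add a \<nu>)
  have "z_part (add_mset a \<nu>) = (a * Suc (count \<nu> a)) * z_part \<nu>" by (rule z_part_add_mset)
  also have "\<dots> \<le> ((a + sum_mset \<nu>) * Suc (size \<nu>)) * ((a + sum_mset \<nu>) ^ size \<nu> * fact (size \<nu>))"
    using add count_le_size[of \<nu> a]
    by (intro mult_mono order_trans[OF add.IH] power_mono) auto
  finally show ?case by (simp add: algebra_simps)
qed

lemma sum_mset_eq_sum_count: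
  fixes f :: "nat \<Rightarrow> complex"
  assumes "finite A" "set_mset \<nu> \<subseteq> A"
  shows "(\<Sum>c\<in>#\<nu>. f c) = (\<Sum>c\<in>A. of_nat (count \<nu> c) * f c)"
  using assms(2)
proof (induction \<nu>)
  case (add x \<nu>)
  have "(\<Sum>c\<in>A. of_nat (count (add_mset x \<nu>) c) * f c) =
      (\<Sum>c\<in>A. (if c = x then f c else 0) + of_nat (count \<nu> c) * f c)"
    by (intro sum.cong) (auto simp: algebra_simps)
  then show ?case using add assms(1) by (simp add: sum.distrib)
qed simp

text \<open>The covariance of power sums of independent complex Gaussian variables \<open>p\<^sub>a\<close> of variance \<open>a\<close>.\<close>

definition gram :: "nat multiset \<Rightarrow> nat multiset \<Rightarrow> complex" where
  "gram \<kappa> \<nu> = (if \<kappa> = \<nu> then of_nat (z_part \<kappa>) else 0)"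

lemma gram_commute: "gram \<kappa> \<nu> = gram \<nu> \<kappa>"
  by (auto simp: gram_def)

text \<open>Wick's rule: the variable of index \<open>a\<close> is contracted with one of its
  \<open>count \<nu> a\<close> conjugate copies, each contraction contributing the variance
  \<open>a\<close>.\<close>

lemma gram_add_left:
  "gram (add_mset a \<kappa>) \<nu> = of_nat a * of_nat (count \<nu> a) * gram \<kappa> (\<nu> - {#a#})"
proof (cases "a \<in># \<nu>")
  case True
  then obtain \<nu>' where "\<nu> = add_mset a \<nu>'" by (metis insert_DiffM)
  then show ?thesis by (auto simp: gram_def z_part_add_mset algebra_simps)
next
  case False
  then show ?thesis by (auto simp: gram_def not_in_iff)
qed

lemma gram_add_right:
  "gram \<kappa> (add_mset a \<nu>) = of_nat a * of_nat (count \<kappa> a) * gram (\<kappa> - {#a#}) \<nu>"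
  using gram_add_left[of a \<nu> \<kappa>] by (simp add: gram_commute)

text \<open>Apply Wick's rule to a part c of \<open>\<nu>\<close>. Parts equal to \<open>a\<close>
  account for the term with \<open>K\<close>, smaller ones for the splittings of \<open>a\<close>,
  larger ones for joining \<open>a\<close> to a part of \<open>\<kappa>\<close>. The identity holds
  for every \<open>K\<close>; it is used with \<open>K\<close> the size of the matrices.\<close>

lemma gram_loop:
  fixes K :: complex
  assumes l: "0 \<notin># \<kappa>" "0 \<notin># \<nu>" and a: "1 \<le> a"
  shows "K * gram (add_mset a \<kappa>) \<nu> + (\<Sum>b\<in>{1..<a}. gram (add_mset b (add_mset (a - b) \<kappa>)) \<nu>)
      + (\<Sum>c\<in>#\<kappa>. of_nat c * gram (add_mset (a + c) (\<kappa> - {#c#})) \<nu>)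
    = (\<Sum>c\<in>#\<nu>. of_nat c *
        (if c = a then K * gram \<kappa> (\<nu> - {#c#})
         else if c < a then gram (add_mset (a - c) \<kappa>) (\<nu> - {#c#})
         else gram \<kappa> (add_mset (c - a) (\<nu> - {#c#}))))"
    (is "_ = (\<Sum>c\<in>#\<nu>. ?F c)")
proof -
  \<comment> \<open>\<open>m\<close> bounds the parts of both multisets. The longer range up to
    \<open>m + a\<close> for \<open>\<nu>\<close> is chosen so that its portion above
    \<open>a\<close>, shifted down by \<open>a\<close>, is the range used for
    \<open>\<kappa>\<close>.\<close>
  define m where "m = sum_mset \<kappa> + sum_mset \<nu>"
  have mem: "x \<le> sum_mset \<tau>" if "x \<in># \<tau>" for x and \<tau> :: "nat multiset"
    using sum_mset.remove[OF that] by simp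
  have "x \<in> {1..m}" if "x \<in># \<kappa>" for x
    using mem[OF that] l(1) that by (cases "x = 0") (auto simp: m_def)
  moreover have "x \<in> {1..m + a}" if "x \<in># \<nu>" for x
    using mem[OF that] l(2) that by (cases "x = 0") (auto simp: m_def)
  ultimately have sub: "set_mset \<kappa> \<subseteq> {1..m}" "set_mset \<nu> \<subseteq> {1..m + a}" by blast+
  have split: "{1..m + a} = {1..<a} \<union> ({a} \<union> {1 + a..m + a})" using a by auto
  have "(\<Sum>c\<in>#\<nu>. ?F c) = (\<Sum>c\<in>{1..m + a}. of_nat (count \<nu> c) * ?F c)"
    by (rule sum_mset_eq_sum_count[OF _ sub(2)]) simp
  also have "\<dots> = (\<Sum>c\<in>{1..<a}. of_nat (count \<nu> c) * ?F c) +
      (of_nat (count \<nu> a) * ?F a + (\<Sum>c\<in>{1 + a..m + a}. of_nat (count \<nu> c) * ?F c))"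
    unfolding split by (subst sum.union_disjoint, simp, simp, force)+ simp
  also have "(\<Sum>c\<in>{1..<a}. of_nat (count \<nu> c) * ?F c) =
      (\<Sum>b\<in>{1..<a}. gram (add_mset b (add_mset (a - b) \<kappa>)) \<nu>)"
    by (intro sum.cong) (auto simp: gram_add_left[of _ "add_mset _ _"] mult_ac)
  also have "of_nat (count \<nu> a) * ?F a = K * gram (add_mset a \<kappa>) \<nu>"
    by (simp add: gram_add_left mult_ac)
  also have "(\<Sum>c\<in>{1 + a..m + a}. of_nat (count \<nu> c) * ?F c) =
      (\<Sum>d\<in>{1..m}. of_nat (count \<nu> (d + a)) * ?F (d + a))"
    by (rule sum.shift_bounds_cl_nat_ivl)
  also have "\<dots> = (\<Sum>d\<in>{1..m}. of_nat (count \<kappa> d) *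
      (of_nat d * gram (add_mset (a + d) (\<kappa> - {#d#})) \<nu>))"
    by (intro sum.cong refl) (simp add: gram_add_left gram_add_right add.commute mult_ac)
  also have "\<dots> = (\<Sum>c\<in>#\<kappa>. of_nat c * gram (add_mset (a + c) (\<kappa> - {#c#})) \<nu>)"
    by (rule sum_mset_eq_sum_count[OF _ sub(1), symmetric]) simp
  finally show ?thesis by simp
qed

lemma finite_partitions_of:
  fixes n :: nat
  shows "finite {\<nu>. 0 \<notin># \<nu> \<and> sum_mset \<nu> = n}"
proof (rule finite_subset)
  show "{\<nu>. 0 \<notin># \<nu> \<and> sum_mset \<nu> = n} \<subseteq> mset ` {xs. set xs \<subseteq> {..n} \<and> length xs \<le> n}"
  proof
    fix \<nu> :: "nat multiset" assume "\<nu> \<in> {\<nu>. 0 \<notin># \<nu> \<and> sum_mset \<nu> = n}"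
    then have nu: "0 \<notin># \<nu>" "sum_mset \<nu> = n" by auto
    obtain xs where xs: "\<nu> = mset xs" by (metis ex_mset)
    have "size \<nu> = (\<Sum>c\<in>#\<nu>. 1)" by simp
    also have "\<dots> \<le> (\<Sum>c\<in>#\<nu>. c)"
      using nu(1) by (intro sum_mset_mono) (metis One_nat_def Suc_leI gr0I)
    finally have "length xs \<le> n" using nu xs by simp
    moreover have "set xs \<subseteq> {..n}"
      using nu(2) xs by (auto simp: sum_mset_sum_list member_le_sum_list)
    ultimately show "\<nu> \<in> mset ` {xs. set xs \<subseteq> {..n} \<and> length xs \<le> n}"
      using xs by blast
  qed
  show "finite (mset ` {xs. set xs \<subseteq> {..n} \<and> length xs \<le> n})"
    by (intro finite_imageI finite_lists_length_le) simp
qed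

section \<open>Moments of power sums\<close>

lemma pow_mat_add:
  assumes "g \<in> carrier_mat n n"
  shows "g ^\<^sub>m (a + b) = g ^\<^sub>m a * g ^\<^sub>m b"
proof (induction b)
  case 0
  then show ?case using assms right_mult_one_mat[of "g ^\<^sub>m a" n n] by simp
next
  case (Suc b)
  then show ?case using assms assoc_mult_mat[of "g ^\<^sub>m a" n n "g ^\<^sub>m b" n g n] by simp
qed

lemma sum_pow_mat_entries:
  assumes "g \<in> carrier_mat n n" "i < n" "j < n"
  shows "(\<Sum>k<n. (g ^\<^sub>m a) $$ (i, k) * (g ^\<^sub>m b) $$ (k, j)) = (g ^\<^sub>m (a + b)) $$ (i, j)"
  using assms index_mult_mat_sum[of "g ^\<^sub>m a" n n "g ^\<^sub>m b" n i j] by (simp add: pow_mat_add)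

lemma mat_trace_pow: "g \<in> carrier_mat n n \<Longrightarrow> mat_trace (g ^\<^sub>m a) = (\<Sum>i<n. (g ^\<^sub>m a) $$ (i, i))"
  by (simp add: mat_trace_def)

definition power_sum :: "nat multiset \<Rightarrow> complex mat \<Rightarrow> complex" where
  "power_sum \<kappa> g = (\<Prod>c\<in>#\<kappa>. mat_trace (g ^\<^sub>m c))"

lemma power_sum_empty [simp]: "power_sum {#} g = 1"
  by (simp add: power_sum_def)

lemma power_sum_add_mset [simp]:
  "power_sum (add_mset c \<kappa>) g = mat_trace (g ^\<^sub>m c) * power_sum \<kappa> g"
  by (simp add: power_sum_def)

lemma trace_mult_power_sum_diff:
  "c \<in># \<kappa> \<Longrightarrow> mat_trace (g ^\<^sub>m c) * power_sum (\<kappa> - {#c#}) g = power_sum \<kappa> g"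
  by (metis insert_DiffM power_sum_add_mset)

lemma sum_sum_mset_swap:
  "(\<Sum>i\<in>A. \<Sum>c\<in>#M. h i c) = (\<Sum>c\<in>#M. \<Sum>i\<in>A. (h i c :: 'a :: comm_monoid_add))"
  by (induction M) (simp_all add: sum.distrib)

lemma cnj_sum_mset: "cnj (\<Sum>c\<in>#M. f c) = (\<Sum>c\<in>#M. cnj (f c))"
  by (induction M) simp_all

lemma norm_sum_mset:
  fixes f :: "'a \<Rightarrow> complex"
  shows "norm (\<Sum>c\<in>#M. f c) \<le> (\<Sum>c\<in>#M. norm (f c))"
  by (induction M) (auto intro: order_trans[OF norm_triangle_ineq])

lemma sum_mset_diff_complex:
  fixes f h :: "'a \<Rightarrow> complex"
  shows "(\<Sum>c\<in>#M. f c - h c) = (\<Sum>c\<in>#M. f c) - (\<Sum>c\<in>#M. h c)"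
  by (induction M) auto

context haar_unitary
begin

lemma pow_in_U: "g \<in> U \<Longrightarrow> g ^\<^sub>m a \<in> U"
  by (rule unitary_pow_closed)

lemma trace_pow_0: "g \<in> U \<Longrightarrow> mat_trace (g ^\<^sub>m 0) = of_nat N"
  using U_carrier[of g] by (auto simp: mat_trace_def)

text \<open>Leibniz rule: one of the \<open>a\<close> factors \<open>g\<close> becomes
  \<open>X g\<close>, with \<open>b\<close> factors in front of it. As \<open>X\<close> stands to
  the left of the factor it acts on, the power behind it is \<open>a - b\<close> and not one
  less.\<close>

lemma has_grad_pow:
  assumes "i < N" "j < N"
  shows "has_grad (\<lambda>g. (g ^\<^sub>m a) $$ (i, j))
    (\<lambda>u v g. \<Sum>b<a. (g ^\<^sub>m b) $$ (i, u) * (g ^\<^sub>m (a - b)) $$ (v, j))"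
  using assms(2)
proof (induction a arbitrary: j)
  case 0
  show ?case
    by (rule has_grad_cong[OF has_grad_const[of "if i = j then 1 else 0"]])
      (use assms 0 in \<open>auto dest: U_carrier\<close>)
next
  case (Suc a)
  let ?G = "\<lambda>k u v g. \<Sum>b<a. (g ^\<^sub>m b) $$ (i, u) * (g ^\<^sub>m (a - b)) $$ (v, k)"
  have "has_grad (\<lambda>g. \<Sum>k<N. (g ^\<^sub>m a) $$ (i, k) * g $$ (k, j))
    (\<lambda>u v g. \<Sum>k<N. (g ^\<^sub>m a) $$ (i, k) * (if u = k then g $$ (v, j) else 0) + ?G k u v g * g $$ (k, j))"
    using Suc by (intro has_grad_sum has_grad_mult has_grad_entry) auto
  then show ?case
  proof (rule has_grad_cong)
    fix g assume "g \<in> U"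
    then have g: "g \<in> carrier_mat N N" by (rule U_carrier)
    show "(\<Sum>k<N. (g ^\<^sub>m a) $$ (i, k) * g $$ (k, j)) = (g ^\<^sub>m Suc a) $$ (i, j)"
      using sum_pow_mat_entries[OF g assms(1) Suc.prems, of a 1] g by simp
    fix u v assume uv: "u < N" "v < N"
    have "(\<Sum>k<N. (g ^\<^sub>m a) $$ (i, k) * (if u = k then g $$ (v, j) else 0)) =
        (\<Sum>k<N. if u = k then (g ^\<^sub>m a) $$ (i, k) * g $$ (v, j) else 0)"
      by (intro sum.cong) auto
    also have "\<dots> = (g ^\<^sub>m a) $$ (i, u) * g $$ (v, j)" using uv by simp
    finally have 1: "(\<Sum>k<N. (g ^\<^sub>m a) $$ (i, k) * (if u = k then g $$ (v, j) else 0)) =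
        (g ^\<^sub>m a) $$ (i, u) * g $$ (v, j)" .
    have "(\<Sum>k<N. ?G k u v g * g $$ (k, j)) =
        (\<Sum>b<a. (g ^\<^sub>m b) $$ (i, u) * (\<Sum>k<N. (g ^\<^sub>m (a - b)) $$ (v, k) * g $$ (k, j)))"
      unfolding sum_distrib_right sum_distrib_left mult.assoc by (rule sum.swap)
    then have "(\<Sum>k<N. (g ^\<^sub>m a) $$ (i, k) * (if u = k then g $$ (v, j) else 0) + ?G k u v g * g $$ (k, j))
        = (g ^\<^sub>m a) $$ (i, u) * g $$ (v, j)
          + (\<Sum>b<a. (g ^\<^sub>m b) $$ (i, u) * (\<Sum>k<N. (g ^\<^sub>m (a - b)) $$ (v, k) * g $$ (k, j)))"
      unfolding sum.distrib 1 by simp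
    also have "(\<Sum>b<a. (g ^\<^sub>m b) $$ (i, u) * (\<Sum>k<N. (g ^\<^sub>m (a - b)) $$ (v, k) * g $$ (k, j)))
        = (\<Sum>b<a. (g ^\<^sub>m b) $$ (i, u) * (g ^\<^sub>m (Suc a - b)) $$ (v, j))"
    proof (intro sum.cong refl)
      fix b assume "b \<in> {..<a}"
      then show "(g ^\<^sub>m b) $$ (i, u) * (\<Sum>k<N. (g ^\<^sub>m (a - b)) $$ (v, k) * g $$ (k, j))
        = (g ^\<^sub>m b) $$ (i, u) * (g ^\<^sub>m (Suc a - b)) $$ (v, j)"
        using sum_pow_mat_entries[OF g uv(2) Suc.prems, of "a - b" 1] g
        by (simp add: Suc_diff_le)
    qed
    finally show "(\<Sum>k<N. (g ^\<^sub>m a) $$ (i, k) * (if u = k then g $$ (v, j) else 0) + ?G k u v g * g $$ (k, j))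
        = (\<Sum>b<Suc a. (g ^\<^sub>m b) $$ (i, u) * (g ^\<^sub>m (Suc a - b)) $$ (v, j))"
      using g by simp
  qed
qed

text \<open>Cyclicity of the trace makes all \<open>c\<close> terms of the Leibniz rule
  equal.\<close>

lemma has_grad_trace_pow:
  "has_grad (\<lambda>g. mat_trace (g ^\<^sub>m c)) (\<lambda>u v g. of_nat c * (g ^\<^sub>m c) $$ (v, u))"
proof (rule has_grad_cong)
  show "has_grad (\<lambda>g. \<Sum>i<N. (g ^\<^sub>m c) $$ (i, i))
      (\<lambda>u v g. \<Sum>i<N. \<Sum>b<c. (g ^\<^sub>m b) $$ (i, u) * (g ^\<^sub>m (c - b)) $$ (v, i))"
    by (intro has_grad_sum has_grad_pow) auto
  fix g assume "g \<in> U"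
  then have g: "g \<in> carrier_mat N N" by (rule U_carrier)
  show "(\<Sum>i<N. (g ^\<^sub>m c) $$ (i, i)) = mat_trace (g ^\<^sub>m c)"
    using g by (simp add: mat_trace_pow)
  fix u v assume uv: "u < N" "v < N"
  have "(\<Sum>i<N. \<Sum>b<c. (g ^\<^sub>m b) $$ (i, u) * (g ^\<^sub>m (c - b)) $$ (v, i))
      = (\<Sum>b<c. \<Sum>i<N. (g ^\<^sub>m (c - b)) $$ (v, i) * (g ^\<^sub>m b) $$ (i, u))"
    by (subst sum.swap) (simp add: mult.commute)
  then show "(\<Sum>i<N. \<Sum>b<c. (g ^\<^sub>m b) $$ (i, u) * (g ^\<^sub>m (c - b)) $$ (v, i))
      = of_nat c * (g ^\<^sub>m c) $$ (v, u)"
    using sum_pow_mat_entries[OF g uv(2,1)] by simp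
qed

lemma has_grad_power_sum:
  "has_grad (power_sum \<kappa>)
    (\<lambda>u v g. \<Sum>c\<in>#\<kappa>. of_nat c * (g ^\<^sub>m c) $$ (v, u) * power_sum (\<kappa> - {#c#}) g)"
proof (induction \<kappa>)
  case empty
  show ?case using has_grad_const[of 1] by (simp add: power_sum_def[abs_def])
next
  case (add x \<kappa>)
  show ?case
  proof (rule has_grad_cong[OF has_grad_mult[OF has_grad_trace_pow[of x] add.IH]])
    fix u v g
    have "(\<Sum>c\<in>#\<kappa>. of_nat c * (g ^\<^sub>m c) $$ (v, u) * power_sum (add_mset x \<kappa> - {#c#}) g) =
        (\<Sum>c\<in>#\<kappa>. mat_trace (g ^\<^sub>m x) * (of_nat c * (g ^\<^sub>m c) $$ (v, u) * power_sum (\<kappa> - {#c#}) g))"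
      by (intro arg_cong[where f = sum_mset] image_mset_cong) (simp add: mult_ac)
    then show "mat_trace (g ^\<^sub>m x) * (\<Sum>c\<in>#\<kappa>. of_nat c * (g ^\<^sub>m c) $$ (v, u) * power_sum (\<kappa> - {#c#}) g)
        + of_nat x * (g ^\<^sub>m x) $$ (v, u) * power_sum \<kappa> g =
      (\<Sum>c\<in>#add_mset x \<kappa>. of_nat c * (g ^\<^sub>m c) $$ (v, u) * power_sum (add_mset x \<kappa> - {#c#}) g)"
      unfolding sum_mset_distrib_left by (simp add: add.commute)
  qed simp
qed

section \<open>Moments and their loop equations\<close>

lemma bounded_meas_power_sum [intro]: "bounded_meas (power_sum \<kappa>)"
  by (rule has_gradD(1)[OF has_grad_power_sum])

lemma bounded_meas_sum_mset [intro]: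
  "(\<And>x. x \<in># A \<Longrightarrow> bounded_meas (f x)) \<Longrightarrow> bounded_meas (\<lambda>g. \<Sum>x\<in>#A. f x g)"
  by (induction A) auto

lemma integral_sum_mset:
  fixes f :: "'b \<Rightarrow> complex mat \<Rightarrow> complex"
  assumes "\<And>x. x \<in># A \<Longrightarrow> bounded_meas (f x)"
  shows "(LINT g|\<mu>. (\<Sum>x\<in>#A. f x g)) = (\<Sum>x\<in>#A. LINT g|\<mu>. f x g)"
  using assms
proof (induction A)
  case (add x A)
  then have "bounded_meas (f x)" "bounded_meas (\<lambda>g. \<Sum>x\<in>#A. f x g)" by auto
  then show ?case using add by (simp add: bounded_meas_integrable)
qed simp

definition moment :: "nat multiset \<Rightarrow> nat multiset \<Rightarrow> complex" where
  "moment \<kappa> \<nu> = (LINT g|\<mu>. power_sum \<kappa> g * cnj (power_sum \<nu> g))"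

text \<open>A part 0 stands for the trace of the identity. In the loop equations it is the source of
  the diagonal coefficient \<open>N\<close>.\<close>

lemma moment_add_zero: "moment (add_mset 0 \<kappa>) \<nu> = of_nat N * moment \<kappa> \<nu>"
proof -
  have "moment (add_mset 0 \<kappa>) \<nu> = (LINT g|\<mu>. of_nat N * (power_sum \<kappa> g * cnj (power_sum \<nu> g)))"
    unfolding moment_def
    by (intro Bochner_Integration.integral_cong) (auto simp: space_haar trace_pow_0 simp del: pow_mat.simps)
  then show ?thesis by (simp add: moment_def)
qed

lemma bounded_meas_moment: "bounded_meas (\<lambda>g. power_sum \<kappa> g * cnj (power_sum \<nu> g))"
  by (intro bounded_meas_mult bounded_meas_cnj bounded_meas_power_sum)

lemma has_grad_moment:
  "has_grad (\<lambda>g. power_sum \<kappa> g * cnj (power_sum \<nu> g))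
    (\<lambda>u v g. power_sum \<kappa> g * - cnj (\<Sum>c\<in>#\<nu>. of_nat c * (g ^\<^sub>m c) $$ (u, v) * power_sum (\<nu> - {#c#}) g)
      + (\<Sum>c\<in>#\<kappa>. of_nat c * (g ^\<^sub>m c) $$ (v, u) * power_sum (\<kappa> - {#c#}) g) * cnj (power_sum \<nu> g))"
  by (rule has_grad_mult[OF has_grad_power_sum has_grad_cnj[OF has_grad_power_sum]])

text \<open>The diagonal matrix units add up to the identity, which generates the scalar rotations.
  Under these \<open>power_sum\<close> is homogeneous, so the derivative multiplies the integrand by
  the difference of the two degrees.\<close>

lemma moment_eq_0_of_degree_neq:
  assumes "sum_mset \<kappa> \<noteq> sum_mset \<nu>"
  shows "moment \<kappa> \<nu> = 0"
proof -
  let ?f = "\<lambda>g. power_sum \<kappa> g * cnj (power_sum \<nu> g)"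
  let ?G = "\<lambda>u g. power_sum \<kappa> g * - cnj (\<Sum>c\<in>#\<nu>. of_nat c * (g ^\<^sub>m c) $$ (u, u) * power_sum (\<nu> - {#c#}) g)
      + (\<Sum>c\<in>#\<kappa>. of_nat c * (g ^\<^sub>m c) $$ (u, u) * power_sum (\<kappa> - {#c#}) g) * cnj (power_sum \<nu> g)"
  have euler: "(\<Sum>u<N. \<Sum>c\<in>#\<tau>. of_nat c * (g ^\<^sub>m c) $$ (u, u) * power_sum (\<tau> - {#c#}) g)
      = of_nat (sum_mset \<tau>) * power_sum \<tau> g" if g: "g \<in> U" for g \<tau>
  proof -
    have "(\<Sum>u<N. \<Sum>c\<in>#\<tau>. of_nat c * (g ^\<^sub>m c) $$ (u, u) * power_sum (\<tau> - {#c#}) g)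
        = (\<Sum>c\<in>#\<tau>. \<Sum>u<N. of_nat c * (g ^\<^sub>m c) $$ (u, u) * power_sum (\<tau> - {#c#}) g)"
      by (rule sum_sum_mset_swap)
    also have "\<dots> = (\<Sum>c\<in>#\<tau>. of_nat c * power_sum \<tau> g)"
      using trace_mult_power_sum_diff[of _ \<tau> g]
      by (intro arg_cong[where f = sum_mset] image_mset_cong)
        (simp add: sum_distrib_left[symmetric] sum_distrib_right[symmetric] mult.assoc
          mat_trace_pow[OF U_carrier[OF g]])
    also have "\<dots> = of_nat (sum_mset \<tau>) * power_sum \<tau> g"
      by (simp add: sum_mset_distrib_right[symmetric] of_nat_sum_mset)
    finally show ?thesis .
  qed
  have "0 = (\<Sum>u<N. LINT g|\<mu>. ?G u g)"
    using integral_grad_eq_0[OF has_grad_moment] by simp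
  also have "\<dots> = (LINT g|\<mu>. (\<Sum>u<N. ?G u g))"
    using has_gradD(2)[OF has_grad_moment]
    by (intro Bochner_Integration.integral_sum[symmetric] bounded_meas_integrable) auto
  also have "\<dots> = (LINT g|\<mu>. (of_nat (sum_mset \<kappa>) - of_nat (sum_mset \<nu>)) * ?f g)"
  proof (rule Bochner_Integration.integral_cong[OF refl])
    fix g assume "g \<in> space \<mu>"
    then have g: "g \<in> U" by (simp add: space_haar)
    show "(\<Sum>u<N. ?G u g) = (of_nat (sum_mset \<kappa>) - of_nat (sum_mset \<nu>)) * ?f g"
      unfolding sum.distrib sum_distrib_left[symmetric] sum_distrib_right[symmetric] sum_negf
        cnj_sum[symmetric] euler[OF g]
      by (simp add: algebra_simps del: of_nat_sum_mset)
  qed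
  also have "\<dots> = (of_nat (sum_mset \<kappa>) - of_nat (sum_mset \<nu>)) * moment \<kappa> \<nu>"
    by (simp add: moment_def)
  finally show ?thesis using assms by (simp del: of_nat_sum_mset)
qed

text \<open>The double sum is the trace of the power \<open>a\<close> times the adjoint of the power
  \<open>c\<close>; by unitarity the adjoint cancels \<open>c\<close> of the \<open>a\<close>
  factors.\<close>

lemma sum_pow_cnj_pow:
  assumes g: "g \<in> U" and "c \<le> a"
  shows "(\<Sum>i<N. \<Sum>j<N. (g ^\<^sub>m a) $$ (i, j) * cnj ((g ^\<^sub>m c) $$ (i, j))) = mat_trace (g ^\<^sub>m (a - c))"
proof -
  define d where "d = a - c"
  have a: "a = d + c" using assms by (simp add: d_def)
  have gc: "g \<in> carrier_mat N N" by (rule U_carrier[OF g])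
  have hU: "g ^\<^sub>m c \<in> U" by (rule pow_in_U[OF g])
  then have h: "g ^\<^sub>m c * mat_adjoint (g ^\<^sub>m c) = 1\<^sub>m N" by (simp add: unitary_group_def)
  have orth: "(\<Sum>j<N. (g ^\<^sub>m c) $$ (k, j) * cnj ((g ^\<^sub>m c) $$ (i, j))) = (if k = i then 1 else 0)"
    if "k < N" "i < N" for i k
  proof -
    have "(\<Sum>j<N. (g ^\<^sub>m c) $$ (k, j) * cnj ((g ^\<^sub>m c) $$ (i, j))) = (g ^\<^sub>m c * mat_adjoint (g ^\<^sub>m c)) $$ (k, i)"
      using index_mult_mat_sum[OF U_carrier[OF hU] mat_adjoint_carrier[OF U_carrier[OF hU]] that] that
      by (simp add: mat_adjoint_index[OF U_carrier[OF hU]])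
    then show ?thesis using h that by simp
  qed
  have "(\<Sum>i<N. \<Sum>j<N. (g ^\<^sub>m a) $$ (i, j) * cnj ((g ^\<^sub>m c) $$ (i, j))) =
      (\<Sum>i<N. \<Sum>j<N. \<Sum>k<N. (g ^\<^sub>m d) $$ (i, k) * ((g ^\<^sub>m c) $$ (k, j) * cnj ((g ^\<^sub>m c) $$ (i, j))))"
    using sum_pow_mat_entries[OF gc, of _ _ d c, symmetric]
    by (intro sum.cong) (auto simp: a sum_distrib_right mult.assoc)
  also have "\<dots> = (\<Sum>i<N. \<Sum>k<N. (g ^\<^sub>m d) $$ (i, k) * (\<Sum>j<N. (g ^\<^sub>m c) $$ (k, j) * cnj ((g ^\<^sub>m c) $$ (i, j))))"
    unfolding sum_distrib_left by (intro sum.cong refl sum.swap)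
  also have "\<dots> = (\<Sum>i<N. \<Sum>k<N. if k = i then (g ^\<^sub>m d) $$ (i, k) else 0)"
    by (intro sum.cong) (auto simp: orth)
  also have "\<dots> = mat_trace (g ^\<^sub>m d)"
    by (simp add: mat_trace_pow[OF gc])
  finally show ?thesis by (simp add: d_def)
qed

text \<open>The loop (Schwinger-Dyson) equation: \<open>\<Sum>\<^sub>i\<^sub>j\<close> of the \<open>(i, j)\<close> derivative of
  \<open>(g\<^sup>a)\<^sub>i\<^sub>j p\<^sub>\<kappa> p\<^sub>\<nu>\<^sup>*\<close> integrates to zero.\<close>

lemma moment_loop:
  "(\<Sum>b<a. moment (add_mset b (add_mset (a - b) \<kappa>)) \<nu>)
    + (\<Sum>c\<in>#\<kappa>. of_nat c * moment (add_mset (a + c) (\<kappa> - {#c#})) \<nu>)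
    = (\<Sum>c\<in>#\<nu>. of_nat c * (if c \<le> a then moment (add_mset (a - c) \<kappa>) (\<nu> - {#c#})
                           else moment \<kappa> (add_mset (c - a) (\<nu> - {#c#}))))"
proof -
  let ?P = "\<lambda>g. power_sum \<kappa> g" and ?Q = "\<lambda>g. cnj (power_sum \<nu> g)"
  let ?A = "\<lambda>u v g. \<Sum>c\<in>#\<nu>. of_nat c * (g ^\<^sub>m c) $$ (u, v) * power_sum (\<nu> - {#c#}) g"
  let ?B = "\<lambda>u v g. \<Sum>c\<in>#\<kappa>. of_nat c * (g ^\<^sub>m c) $$ (v, u) * power_sum (\<kappa> - {#c#}) g"
  let ?G = "\<lambda>i j u v g. (g ^\<^sub>m a) $$ (i, j) * (?P g * - cnj (?A u v g) + ?B u v g * ?Q g)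
    + (\<Sum>b<a. (g ^\<^sub>m b) $$ (i, u) * (g ^\<^sub>m (a - b)) $$ (v, j)) * (?P g * ?Q g)"
  have grad: "has_grad (\<lambda>g. (g ^\<^sub>m a) $$ (i, j) * (?P g * ?Q g)) (?G i j)" if "i < N" "j < N" for i j
    by (rule has_grad_mult[OF has_grad_pow[OF that] has_grad_moment])
  let ?L = "\<lambda>g. \<Sum>b<a. power_sum (add_mset b (add_mset (a - b) \<kappa>)) g * ?Q g"
  let ?J = "\<lambda>g. \<Sum>c\<in>#\<kappa>. of_nat c * (power_sum (add_mset (a + c) (\<kappa> - {#c#})) g * ?Q g)"
  let ?R = "\<lambda>g. \<Sum>c\<in>#\<nu>. of_nat c *
    (if c \<le> a then power_sum (add_mset (a - c) \<kappa>) g * cnj (power_sum (\<nu> - {#c#}) g)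
     else ?P g * cnj (power_sum (add_mset (c - a) (\<nu> - {#c#})) g))"
  have pointwise: "(\<Sum>i<N. \<Sum>j<N. ?G i j i j g) = ?L g + ?J g - ?R g" if g: "g \<in> U" for g
  proof -
    have gc: "g \<in> carrier_mat N N" by (rule U_carrier[OF g])
    have swap: "(\<Sum>i<N. \<Sum>j<N. \<Sum>c\<in>#M. h i j c) = (\<Sum>c\<in>#M. \<Sum>i<N. \<Sum>j<N. h i j c)"
      for h :: "nat \<Rightarrow> nat \<Rightarrow> nat \<Rightarrow> complex" and M
      by (simp only: sum_sum_mset_swap)
    \<comment> \<open>Differentiating the power itself breaks it into two traces, of orders
      \<open>b\<close> and \<open>a - b\<close>.\<close>
    have 1: "(\<Sum>i<N. \<Sum>j<N. (\<Sum>b<a. (g ^\<^sub>m b) $$ (i, i) * (g ^\<^sub>m (a - b)) $$ (j, j)) * (?P g * ?Q g)) = ?L g"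
    proof -
      have "(\<Sum>i<N. \<Sum>j<N. (\<Sum>b<a. (g ^\<^sub>m b) $$ (i, i) * (g ^\<^sub>m (a - b)) $$ (j, j)) * (?P g * ?Q g))
          = (\<Sum>b<a. \<Sum>i<N. \<Sum>j<N. (g ^\<^sub>m b) $$ (i, i) * (g ^\<^sub>m (a - b)) $$ (j, j) * (?P g * ?Q g))"
        unfolding sum_distrib_right sum.swap[of _ "{..<a}" "{..<N}"] ..
      also have "\<dots> = ?L g"
        by (intro sum.cong refl)
          (simp add: mat_trace_pow[OF gc] sum_product sum_distrib_right[symmetric] mult.assoc[symmetric])
      finally show ?thesis .
    qed
    \<comment> \<open>Differentiating an unconjugated trace joins its order to
      \<open>a\<close>.\<close>
    have 2: "(\<Sum>i<N. \<Sum>j<N. (g ^\<^sub>m a) $$ (i, j) * (?B i j g * ?Q g)) = ?J g"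
    proof -
      have "(\<Sum>i<N. \<Sum>j<N. (g ^\<^sub>m a) $$ (i, j) * (?B i j g * ?Q g)) =
         (\<Sum>i<N. \<Sum>j<N. \<Sum>c\<in>#\<kappa>. (g ^\<^sub>m a) $$ (i, j) * (g ^\<^sub>m c) $$ (j, i) *
           (of_nat c * (power_sum (\<kappa> - {#c#}) g * ?Q g)))"
        by (simp add: sum_mset_distrib_left sum_mset_distrib_right multiset.map_comp o_def mult_ac)
      also have "\<dots> = (\<Sum>c\<in>#\<kappa>. (\<Sum>i<N. \<Sum>j<N. (g ^\<^sub>m a) $$ (i, j) * (g ^\<^sub>m c) $$ (j, i)) *
           (of_nat c * (power_sum (\<kappa> - {#c#}) g * ?Q g)))"
        unfolding swap sum_distrib_right ..
      also have "\<dots> = ?J g"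
        by (intro arg_cong[where f = sum_mset] image_mset_cong)
          (simp add: sum_pow_mat_entries[OF gc] mat_trace_pow[OF gc] mult.assoc mult.left_commute[of "of_nat _"])
      finally show ?thesis .
    qed
    \<comment> \<open>A conjugated trace cancels against the power, leaving the difference of the
      orders.\<close>
    have 3: "(\<Sum>i<N. \<Sum>j<N. (g ^\<^sub>m a) $$ (i, j) * (?P g * cnj (?A i j g))) = ?R g"
    proof -
      have "(\<Sum>i<N. \<Sum>j<N. (g ^\<^sub>m a) $$ (i, j) * (?P g * cnj (?A i j g))) =
         (\<Sum>i<N. \<Sum>j<N. \<Sum>c\<in>#\<nu>. (g ^\<^sub>m a) $$ (i, j) * cnj ((g ^\<^sub>m c) $$ (i, j)) *
           (of_nat c * (?P g * cnj (power_sum (\<nu> - {#c#}) g))))"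
        by (simp add: sum_mset_distrib_left cnj_sum_mset multiset.map_comp o_def mult_ac)
      also have "\<dots> = (\<Sum>c\<in>#\<nu>. (\<Sum>i<N. \<Sum>j<N. (g ^\<^sub>m a) $$ (i, j) * cnj ((g ^\<^sub>m c) $$ (i, j))) *
           (of_nat c * (?P g * cnj (power_sum (\<nu> - {#c#}) g))))"
        unfolding swap sum_distrib_right ..
      also have "\<dots> = ?R g"
      proof (intro arg_cong[where f = sum_mset] image_mset_cong)
        fix c
        show "(\<Sum>i<N. \<Sum>j<N. (g ^\<^sub>m a) $$ (i, j) * cnj ((g ^\<^sub>m c) $$ (i, j))) *
           (of_nat c * (?P g * cnj (power_sum (\<nu> - {#c#}) g))) =
           of_nat c * (if c \<le> a then power_sum (add_mset (a - c) \<kappa>) g * cnj (power_sum (\<nu> - {#c#}) g)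
             else ?P g * cnj (power_sum (add_mset (c - a) (\<nu> - {#c#})) g))"
        proof (cases "c \<le> a")
          case True
          then show ?thesis by (simp add: sum_pow_cnj_pow[OF g] mult_ac)
        next
          case False
          \<comment> \<open>Here the conjugated factor has the larger order, so the identity is
            applied with the roles exchanged and then conjugated.\<close>
          then have "(\<Sum>i<N. \<Sum>j<N. (g ^\<^sub>m c) $$ (i, j) * cnj ((g ^\<^sub>m a) $$ (i, j))) = mat_trace (g ^\<^sub>m (c - a))"
            by (intro sum_pow_cnj_pow[OF g]) simp
          from arg_cong[OF this, of cnj]
          have "(\<Sum>i<N. \<Sum>j<N. (g ^\<^sub>m a) $$ (i, j) * cnj ((g ^\<^sub>m c) $$ (i, j))) = cnj (mat_trace (g ^\<^sub>m (c - a)))"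
            by (simp add: mult.commute)
          then show ?thesis using False by (simp add: mult_ac)
        qed
      qed
      finally show ?thesis .
    qed
    have "(\<Sum>i<N. \<Sum>j<N. ?G i j i j g) =
        (\<Sum>i<N. \<Sum>j<N. (\<Sum>b<a. (g ^\<^sub>m b) $$ (i, i) * (g ^\<^sub>m (a - b)) $$ (j, j)) * (?P g * ?Q g))
        + (\<Sum>i<N. \<Sum>j<N. (g ^\<^sub>m a) $$ (i, j) * (?B i j g * ?Q g))
        - (\<Sum>i<N. \<Sum>j<N. (g ^\<^sub>m a) $$ (i, j) * (?P g * cnj (?A i j g)))"
      unfolding sum.distrib[symmetric] sum_subtractf[symmetric]
      by (intro sum.cong refl) (simp add: distrib_left right_diff_distrib)
    then show ?thesis unfolding 1 2 3 .
  qed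
  have bm: "bounded_meas (?G i j i j)" if "i < N" "j < N" for i j
    using has_gradD(2)[OF grad[OF that] that] .
  have bmL: "bounded_meas ?L" and bmJ: "bounded_meas ?J"
    by (intro bounded_meas_sum bounded_meas_sum_mset bounded_meas_mult[OF bounded_meas_const] bounded_meas_moment)+
  have bmR: "bounded_meas (\<lambda>g. of_nat c *
    (if c \<le> a then power_sum (add_mset (a - c) \<kappa>) g * cnj (power_sum (\<nu> - {#c#}) g)
     else ?P g * cnj (power_sum (add_mset (c - a) (\<nu> - {#c#})) g)))" for c
    by (cases "c \<le> a") (auto intro!: bounded_meas_mult[OF bounded_meas_const] bounded_meas_moment simp del: power_sum_add_mset)
  then have bmR': "bounded_meas ?R" by (intro bounded_meas_sum_mset)
  have "0 = (\<Sum>i<N. \<Sum>j<N. (LINT g|\<mu>. ?G i j i j g))"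
    using integral_grad_eq_0[OF grad] by simp
  also have "\<dots> = (\<Sum>i<N. (LINT g|\<mu>. (\<Sum>j<N. ?G i j i j g)))"
    using bm by (intro sum.cong refl Bochner_Integration.integral_sum[symmetric] bounded_meas_integrable) auto
  also have "\<dots> = (LINT g|\<mu>. (\<Sum>i<N. \<Sum>j<N. ?G i j i j g))"
    using bm by (intro Bochner_Integration.integral_sum[symmetric] bounded_meas_integrable bounded_meas_sum) auto
  also have "\<dots> = (LINT g|\<mu>. ?L g + ?J g - ?R g)"
    by (intro Bochner_Integration.integral_cong refl pointwise) (simp add: space_haar)
  also have "\<dots> = (LINT g|\<mu>. ?L g) + (LINT g|\<mu>. ?J g) - (LINT g|\<mu>. ?R g)"
    using bmL bmJ bmR' by (simp add: bounded_meas_integrable del: power_sum_add_mset)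
  also have "(LINT g|\<mu>. ?L g) = (\<Sum>b<a. moment (add_mset b (add_mset (a - b) \<kappa>)) \<nu>)"
    unfolding moment_def
    by (intro Bochner_Integration.integral_sum bounded_meas_integrable bounded_meas_moment)
  also have "(LINT g|\<mu>. ?J g) = (\<Sum>c\<in>#\<kappa>. of_nat c * moment (add_mset (a + c) (\<kappa> - {#c#})) \<nu>)"
    unfolding moment_def
    by (subst integral_sum_mset; (intro bounded_meas_mult[OF bounded_meas_const] bounded_meas_moment)?) simp
  also have "(LINT g|\<mu>. ?R g) = (\<Sum>c\<in>#\<nu>. of_nat c * (if c \<le> a then moment (add_mset (a - c) \<kappa>) (\<nu> - {#c#})
                           else moment \<kappa> (add_mset (c - a) (\<nu> - {#c#}))))"
    unfolding moment_def
    by (subst integral_sum_mset[OF bmR], intro arg_cong[where f = sum_mset] image_mset_cong) simp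
  finally show ?thesis by simp
qed

lemma moment_empty: "moment {#} {#} = 1"
  using prob_space by (simp add: moment_def)

text \<open>By the loop equations the defect \<open>moment - gram\<close> in degree \<open>n\<close> solves a homogeneous linear system
  whose diagonal entries are \<open>N\<close> while the off-diagonal entries of each row have absolute sum
  \<open>n - 1 < N\<close>. So it vanishes.\<close>

theorem moment_eq_gram:
  assumes "sum_mset \<kappa> = n" "sum_mset \<nu> = n" "0 \<notin># \<kappa>" "0 \<notin># \<nu>" "n \<le> N"
  shows "moment \<kappa> \<nu> = gram \<kappa> \<nu>"
  using assms
proof (induction n arbitrary: \<kappa> \<nu> rule: less_induct)
  case (less n)
  show ?case
  proof (cases "n = 0")
    case True
    have "\<sigma> = {#}" if "sum_mset \<sigma> = 0" "0 \<notin># \<sigma>" for \<sigma> :: "nat multiset"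
      using that by (cases \<sigma>) auto
    then have "\<kappa> = {#}" "\<nu> = {#}" using less.prems True by simp_all
    then show ?thesis by (simp add: moment_empty gram_def z_part_def)
  next
    case False
    \<comment> \<open>\<open>\<nu>\<close> stays fixed, so the unknowns are indexed by the first
      argument alone.\<close>
    define d where "d \<tau> = moment \<tau> \<nu> - gram \<tau> \<nu>" for \<tau>
    define S where "S = {\<tau>. 0 \<notin># \<tau> \<and> sum_mset \<tau> = n}"
    define M where "M = Max ((\<lambda>\<tau>. norm (d \<tau>)) ` S)"
    have S: "finite S" "\<kappa> \<in> S"
      using finite_partitions_of[of n] less.prems by (auto simp: S_def)
    have le_M: "norm (d \<tau>) \<le> M" if "\<tau> \<in> S" for \<tau>
      unfolding M_def using S that by (intro Max_ge) auto
    have M0: "0 \<le> M" using le_M[OF S(2)] norm_ge_zero order_trans by blast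
    have "M \<in> (\<lambda>\<tau>. norm (d \<tau>)) ` S"
      unfolding M_def using S by (intro Max_in) auto
    \<comment> \<open>A maximal defect selects the row of the system to be used; any part of
      \<open>\<tau>\<close> may serve as \<open>a\<close>.\<close>
    then obtain \<tau> where \<tau>: "\<tau> \<in> S" "norm (d \<tau>) = M" by auto
    have "\<tau> \<noteq> {#}" using \<tau>(1) False by (auto simp: S_def)
    then obtain a \<rho> where \<rho>: "\<tau> = add_mset a \<rho>" by (cases \<tau>) auto
    have a: "1 \<le> a" and \<rho>0: "0 \<notin># \<rho>" and n: "a + sum_mset \<rho> = n"
      using \<tau>(1) by (auto simp: S_def \<rho> Suc_le_eq intro: gr0I)
    have bound: "c \<le> sum_mset \<sigma>" "sum_mset (\<sigma> - {#c#}) = sum_mset \<sigma> - c" if "c \<in># \<sigma>" for c and \<sigma> :: "nat multiset"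
      using sum_mset.remove[OF that] by simp_all
    \<comment> \<open>Every moment on the right of the loop equation has degree below
      \<open>n\<close>, so the induction hypothesis replaces it by \<open>gram\<close>. Equality of
      \<open>c\<close> and \<open>a\<close> leaves a part 0 and hence the factor
      \<open>N\<close>.\<close>
    have rest: "(if c \<le> a then moment (add_mset (a - c) \<rho>) (\<nu> - {#c#})
        else moment \<rho> (add_mset (c - a) (\<nu> - {#c#}))) =
      (if c = a then of_nat N * gram \<rho> (\<nu> - {#c#})
         else if c < a then gram (add_mset (a - c) \<rho>) (\<nu> - {#c#})
         else gram \<rho> (add_mset (c - a) (\<nu> - {#c#})))" if c: "c \<in># \<nu>" for c
    proof -
      have c0: "1 \<le> c" using c less.prems(4) by (cases c) auto
      have c1: "c \<le> n" "sum_mset (\<nu> - {#c#}) = n - c" "0 \<notin># \<nu> - {#c#}"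
        using bound[OF c] less.prems(2,4) by (auto dest: in_diffD)
      consider "c = a" | "c < a" | "a < c" by linarith
      then show ?thesis
      proof cases
        case 1
        have "moment \<rho> (\<nu> - {#c#}) = gram \<rho> (\<nu> - {#c#})"
          using c0 c1 \<rho>0 n less.prems(5) 1 by (intro less.IH[of "n - c"]) auto
        then show ?thesis using 1 by (simp add: moment_add_zero)
      next
        case 2
        have "moment (add_mset (a - c) \<rho>) (\<nu> - {#c#}) = gram (add_mset (a - c) \<rho>) (\<nu> - {#c#})"
          using c0 c1 \<rho>0 n less.prems(5) 2 by (intro less.IH[of "n - c"]) auto
        then show ?thesis using 2 by simp
      next
        case 3
        have "moment \<rho> (add_mset (c - a) (\<nu> - {#c#})) = gram \<rho> (add_mset (c - a) (\<nu> - {#c#}))"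
          using a c1 \<rho>0 n less.prems(5) 3 by (intro less.IH[of "n - a"]) auto
        then show ?thesis using 3 by simp
      qed
    qed
    \<comment> \<open>The term with \<open>b\<close> equal to 0 does not split \<open>a\<close>: it
      is \<open>\<tau>\<close> with an additional part 0, the diagonal term.\<close>
    have ivl: "{..<a} = insert 0 {1..<a}" using a by auto
    have "of_nat N * moment \<tau> \<nu> + (\<Sum>b\<in>{1..<a}. moment (add_mset b (add_mset (a - b) \<rho>)) \<nu>)
        + (\<Sum>c\<in>#\<rho>. of_nat c * moment (add_mset (a + c) (\<rho> - {#c#})) \<nu>) =
        (\<Sum>b<a. moment (add_mset b (add_mset (a - b) \<rho>)) \<nu>)
        + (\<Sum>c\<in>#\<rho>. of_nat c * moment (add_mset (a + c) (\<rho> - {#c#})) \<nu>)"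
      unfolding ivl by (subst sum.insert) (simp_all add: moment_add_zero \<rho>)
    also have "\<dots> = of_nat N * gram \<tau> \<nu> + (\<Sum>b\<in>{1..<a}. gram (add_mset b (add_mset (a - b) \<rho>)) \<nu>)
        + (\<Sum>c\<in>#\<rho>. of_nat c * gram (add_mset (a + c) (\<rho> - {#c#})) \<nu>)"
      unfolding moment_loop \<rho> gram_loop[OF \<rho>0 less.prems(4) a]
      by (intro arg_cong[where f = sum_mset] image_mset_cong) (simp only: rest)
    finally have "of_nat N * d \<tau> = - ((\<Sum>b\<in>{1..<a}. d (add_mset b (add_mset (a - b) \<rho>)))
        + (\<Sum>c\<in>#\<rho>. of_nat c * d (add_mset (a + c) (\<rho> - {#c#}))))"
      unfolding d_def right_diff_distrib sum_subtractf sum_mset_diff_complex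
      by (simp add: algebra_simps add_eq_0_iff)
    also have "norm \<dots> \<le> (\<Sum>b\<in>{1..<a}. M) + (\<Sum>c\<in>#\<rho>. real c * M)"
      unfolding norm_minus_cancel
    proof (intro norm_triangle_mono order_trans[OF norm_sum] order_trans[OF norm_sum_mset] sum_mono sum_mset_mono)
      fix b assume "b \<in> {1..<a}"
      then show "norm (d (add_mset b (add_mset (a - b) \<rho>))) \<le> M"
        using \<rho>0 n by (intro le_M) (auto simp: S_def)
    next
      fix c assume c: "c \<in># \<rho>"
      then have "norm (d (add_mset (a + c) (\<rho> - {#c#}))) \<le> M"
        using \<rho>0 n a bound[OF c] by (intro le_M) (auto simp: S_def dest: in_diffD)
      then show "norm (of_nat c * d (add_mset (a + c) (\<rho> - {#c#}))) \<le> real c * M"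
        by (simp add: norm_mult mult_left_mono)
    qed
    \<comment> \<open>There are \<open>a - 1\<close> proper splittings, and the weights of the
      joinings add up to the sum of \<open>\<rho>\<close>, so the total is \<open>n - 1\<close>
      whichever part was chosen.\<close>
    also have "(\<Sum>b\<in>{1..<a}. M) = (real a - 1) * M"
      using a by (simp add: of_nat_diff)
    also have "(\<Sum>c\<in>#\<rho>. real c * M) = real (sum_mset \<rho>) * M"
      by (simp add: sum_mset_distrib_right)
    also have "(real a - 1) * M + real (sum_mset \<rho>) * M = (real a + real (sum_mset \<rho>) - 1) * M"
      by (simp only: left_diff_distrib distrib_right)
    also have "real a + real (sum_mset \<rho>) = real n"
      unfolding n[symmetric] by (simp only: of_nat_add)
    finally have "real N * M \<le> (real n - 1) * M"
      by (simp add: norm_mult \<tau>(2))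
    moreover have "(real n - 1) * M \<le> (real N - 1) * M"
      using less.prems(5) M0 by (intro mult_right_mono) auto
    ultimately have "M \<le> 0" by (simp add: algebra_simps)
    then have "norm (d \<kappa>) \<le> 0" using le_M[OF S(2)] by linarith
    then show ?thesis by (simp add: d_def)
  qed
qed

end

section \<open>Expansion over compositions\<close>

text \<open>An entry is the exponent taken from one factor of a product of power series; zeros are
  allowed because of the constant terms.\<close>

definition weak_compositions :: "nat \<Rightarrow> nat \<Rightarrow> nat list set" where
  "weak_compositions k n = {\<alpha>. length \<alpha> = k \<and> sum_list \<alpha> = n}"

lemma weak_compositions_subset:
  "weak_compositions k n \<subseteq> {\<alpha>. set \<alpha> \<subseteq> {..n} \<and> length \<alpha> = k}"
  by (auto simp: weak_compositions_def member_le_sum_list)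

lemma finite_weak_compositions [simp]: "finite (weak_compositions k n)"
  by (rule finite_subset[OF weak_compositions_subset finite_lists_length_eq]) simp

lemma card_weak_compositions_le: "card (weak_compositions k n) \<le> (n + 1) ^ k"
  using card_mono[OF finite_lists_length_eq weak_compositions_subset, of n k]
  by (simp add: card_lists_length_eq)

lemma weak_compositions_Suc:
  "weak_compositions (Suc k) n = (\<lambda>(i, \<beta>). i # \<beta>) ` (SIGMA i:{..n}. weak_compositions k (n - i))"
proof (intro equalityI subsetI)
  fix \<alpha> assume "\<alpha> \<in> weak_compositions (Suc k) n"
  then obtain i \<beta> where "\<alpha> = i # \<beta>" "length \<beta> = k" "i + sum_list \<beta> = n"
    by (cases \<alpha>) (auto simp: weak_compositions_def)
  then show "\<alpha> \<in> (\<lambda>(i, \<beta>). i # \<beta>) ` (SIGMA i:{..n}. weak_compositions k (n - i))"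
    by (intro image_eqI[of _ _ "(i, \<beta>)"]) (auto simp: weak_compositions_def)
qed (auto simp: weak_compositions_def)

text \<open>The part of total degree \<open>n\<close> in the product of the power series with
  coefficients \<open>c\<close>, evaluated at the entries of \<open>E\<close>. Grading by total
  degree lets two such products be paired degree by degree.\<close>

definition composition_sum :: "(nat \<Rightarrow> complex) \<Rightarrow> complex list \<Rightarrow> nat \<Rightarrow> complex" where
  "composition_sum c E n =
     (\<Sum>\<alpha>\<in>weak_compositions (length E) n. \<Prod>i<length E. c (\<alpha> ! i) * E ! i ^ (\<alpha> ! i))"

lemma composition_sum_Cons:
  "composition_sum c (e # E) n = (\<Sum>i\<le>n. (c i * e ^ i) * composition_sum c E (n - i))"
proof -
  let ?k = "length E"
  have inj: "inj_on (\<lambda>(i, \<beta>). i # \<beta>) (SIGMA i:{..n}. weak_compositions ?k (n - i))"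
    by (auto simp: inj_on_def)
  have "composition_sum c (e # E) n =
      (\<Sum>(i, \<beta>)\<in>(SIGMA i:{..n}. weak_compositions ?k (n - i)).
        \<Prod>j<Suc ?k. c ((i # \<beta>) ! j) * (e # E) ! j ^ ((i # \<beta>) ! j))"
    unfolding composition_sum_def length_Cons weak_compositions_Suc sum.reindex[OF inj]
    by (simp add: case_prod_unfold)
  also have "\<dots> = (\<Sum>i\<le>n. \<Sum>\<beta>\<in>weak_compositions ?k (n - i).
        \<Prod>j<Suc ?k. c ((i # \<beta>) ! j) * (e # E) ! j ^ ((i # \<beta>) ! j))"
    by (rule sum.Sigma[symmetric]) auto
  also have "\<dots> = (\<Sum>i\<le>n. (c i * e ^ i) * composition_sum c E (n - i))"
    unfolding prod.lessThan_Suc_shift composition_sum_def sum_distrib_left by simp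
  finally show ?thesis .
qed

lemma norm_composition_term_le:
  fixes c :: "nat \<Rightarrow> complex"
  assumes "\<And>n. norm (c n) \<le> K" "\<And>e. e \<in> set E \<Longrightarrow> norm e \<le> r" "0 \<le> r" "0 \<le> K"
    and \<alpha>: "\<alpha> \<in> weak_compositions (length E) n"
  shows "norm (\<Prod>i<length E. c (\<alpha> ! i) * E ! i ^ (\<alpha> ! i)) \<le> K ^ length E * r ^ n"
proof -
  have "norm (\<Prod>i<length E. c (\<alpha> ! i) * E ! i ^ (\<alpha> ! i)) \<le> (\<Prod>i<length E. K * r ^ (\<alpha> ! i))"
    unfolding prod_norm[symmetric] norm_mult norm_power
    using assms by (intro prod_mono) (auto intro!: mult_mono power_mono)
  also have "\<dots> = K ^ length E * r ^ (\<Sum>i<length E. \<alpha> ! i)"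
    by (simp add: prod.distrib power_sum)
  also have "(\<Sum>i<length E. \<alpha> ! i) = n"
    using \<alpha> by (auto simp: weak_compositions_def sum_list_sum_nth atLeast0LessThan)
  finally show ?thesis .
qed

lemma norm_composition_sum_le:
  fixes c :: "nat \<Rightarrow> complex"
  assumes "\<And>n. norm (c n) \<le> K" "\<And>e. e \<in> set E \<Longrightarrow> norm e \<le> r" "0 \<le> r" "0 \<le> K"
  shows "norm (composition_sum c E n) \<le> real (n + 1) ^ length E * K ^ length E * r ^ n"
proof -
  have "norm (composition_sum c E n) \<le> (\<Sum>\<alpha>\<in>weak_compositions (length E) n. K ^ length E * r ^ n)"
    unfolding composition_sum_def
    by (intro order.trans[OF norm_sum] sum_mono norm_composition_term_le assms)
  also have "\<dots> = real (card (weak_compositions (length E) n)) * (K ^ length E * r ^ n)"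
    by simp
  also have "\<dots> \<le> real ((n + 1) ^ length E) * (K ^ length E * r ^ n)"
    using assms(3,4) card_weak_compositions_le[of "length E" n]
    by (intro mult_right_mono) (auto simp del: of_nat_power)
  finally show ?thesis by (simp add: mult.assoc)
qed

section \<open>Convergence of the expansion\<close>

lemma summable_poly_geometric:
  fixes x :: real
  assumes "0 \<le> x" "x < 1"
  shows "summable (\<lambda>n. real (n + d) ^ p * x ^ n)"
proof -
  obtain y where y: "x < y" "y < 1" using dense[OF assms(2)] by blast
  have "(\<lambda>n. ((real n + real d + 1) / (real n + real d)) ^ p * x) \<longlonglongrightarrow> 1 ^ p * x"
  proof (intro tendsto_intros)
    have "(\<lambda>n. (real n + real d + 1) / (real n + real d)) \<longlonglongrightarrow> 1" by real_asymp
    then show "(\<lambda>n. (real n + real d + 1) / (real n + real d)) \<longlonglongrightarrow> 1" .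
  qed
  then have "eventually (\<lambda>n. ((real n + real d + 1) / (real n + real d)) ^ p * x < y) sequentially"
    using y by (intro order_tendstoD(2)) auto
  then obtain M where M: "\<And>n. n \<ge> M \<Longrightarrow> ((real n + real d + 1) / (real n + real d)) ^ p * x < y"
    by (auto simp: eventually_sequentially)
  show ?thesis
  proof (rule summable_ratio_test[OF y(2)])
    \<comment> \<open>Starting at \<open>Suc M\<close> keeps the denominator of the ratio away from
      0 when \<open>d\<close> is 0.\<close>
    fix n assume n: "n \<ge> Suc M"
    let ?q = "(real n + real d + 1) / (real n + real d)"
    have "real (Suc n + d) = ?q * real (n + d)" using n by (simp add: field_simps)
    then have "real (Suc n + d) ^ p = ?q ^ p * real (n + d) ^ p"
      by (simp only: power_mult_distrib)
    then have "real (Suc n + d) ^ p * x ^ Suc n = (?q ^ p * x) * (real (n + d) ^ p * x ^ n)"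
      by (simp only: power_Suc mult_ac)
    also have "\<dots> \<le> y * (real (n + d) ^ p * x ^ n)"
      using M[of n] n assms by (intro mult_right_mono) auto
    finally show "norm (real (Suc n + d) ^ p * x ^ Suc n) \<le> y * norm (real (n + d) ^ p * x ^ n)"
      using assms by (simp add: abs_mult)
  qed
qed

lemma summable_norm_composition_sum:
  fixes c :: "nat \<Rightarrow> complex"
  assumes "\<And>n. norm (c n) \<le> K" "\<And>e. e \<in> set E \<Longrightarrow> norm e \<le> r" "0 \<le> r" "r < 1" "0 \<le> K"
  shows "summable (\<lambda>n. norm (composition_sum c E n))"
proof (rule summable_comparison_test')
  show "summable (\<lambda>n. K ^ length E * (real (n + 1) ^ length E * r ^ n))"
    using assms by (intro summable_mult summable_poly_geometric)
  show "norm (norm (composition_sum c E n)) \<le> K ^ length E * (real (n + 1) ^ length E * r ^ n)" for n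
    using norm_composition_sum_le[OF assms(1,2,3,5), where n = n] by (simp add: mult_ac)
qed

text \<open>Induction on the list by Cauchy products, for which head and tail both converge
  absolutely.\<close>

lemma composition_sum_sums:
  fixes c :: "nat \<Rightarrow> complex"
  assumes c: "\<And>n. norm (c n) \<le> K" and E: "\<And>e. e \<in> set E \<Longrightarrow> norm e \<le> r" and r: "0 \<le> r" "r < 1" "0 \<le> K"
    and s: "\<And>e. e \<in> set E \<Longrightarrow> (\<lambda>n. c n * e ^ n) sums s e"
  shows "composition_sum c E sums (\<Prod>e\<leftarrow>E. s e)"
  using E s
proof (induction E)
  case Nil
  have "weak_compositions 0 n = (if n = 0 then {[]} else {})" for n
    by (auto simp: weak_compositions_def)
  then have "composition_sum c [] = (\<lambda>n. if n = 0 then 1 else 0)"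
    by (auto simp: composition_sum_def)
  then show ?case using sums_single[of 0 "\<lambda>_. 1::complex"] by simp
next
  case (Cons e E)
  have e: "norm e \<le> r" using Cons.prems(1) by simp
  have "summable (\<lambda>n. norm (c n * e ^ n))"
  proof (rule summable_comparison_test')
    show "summable (\<lambda>n. K * r ^ n)" using r by (intro summable_mult summable_geometric) auto
    show "norm (norm (c n * e ^ n)) \<le> K * r ^ n" for n
      using c e r by (auto simp: norm_mult norm_power intro!: mult_mono power_mono)
  qed
  from Cauchy_product_sums[OF this summable_norm_composition_sum[OF c _ r]] Cons.prems(1)
  have "(\<lambda>n. \<Sum>i\<le>n. (c i * e ^ i) * composition_sum c E (n - i)) sums
      ((\<Sum>n. c n * e ^ n) * (\<Sum>n. composition_sum c E n))"
    by simp
  moreover have "(\<Sum>n. c n * e ^ n) = s e"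
    using sums_unique[OF Cons.prems(2)[of e]] by simp
  moreover have "(\<Sum>n. composition_sum c E n) = (\<Prod>e\<leftarrow>E. s e)"
    using sums_unique[OF Cons.IH] Cons.prems by simp
  ultimately show ?case by (simp add: composition_sum_Cons[abs_def])
qed

section \<open>Partitions underlying compositions\<close>

definition positive_parts :: "nat list \<Rightarrow> nat multiset" where
  "positive_parts \<alpha> = filter_mset (\<lambda>a. a \<noteq> 0) (mset \<alpha>)"

lemma sum_positive_parts: "sum_mset (positive_parts \<alpha>) = sum_list \<alpha>"
  by (induction \<alpha>) (auto simp: positive_parts_def)

lemma size_positive_parts_le: "size (positive_parts \<alpha>) \<le> length \<alpha>"
  unfolding positive_parts_def by (metis size_filter_mset_lesseq size_mset)

lemma zero_notin_positive_parts: "0 \<notin># positive_parts \<alpha>"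
  by (simp add: positive_parts_def)

text \<open>Padding with zeros and discarding them are inverse to each other up to rearrangement, so
  the monomials are indexed by the compositions with positive parts \<open>\<nu>\<close>. If
  \<open>\<nu>\<close> is too long there are none, in agreement with the value 0.\<close>

lemma monomial_sym_eq:
  assumes \<nu>: "0 \<notin># \<nu>" "sum_mset \<nu> = n"
  shows "monomial_sym \<nu> xs =
    (\<Sum>\<alpha>\<in>{\<alpha> \<in> weak_compositions (length xs) n. positive_parts \<alpha> = \<nu>}. \<Prod>i<length xs. xs ! i ^ (\<alpha> ! i))"
proof (cases "size \<nu> \<le> length xs")
  case True
  have "mset \<alpha> = \<nu> + replicate_mset (length xs - size \<nu>) 0 \<longleftrightarrow>
      length \<alpha> = length xs \<and> sum_list \<alpha> = n \<and> positive_parts \<alpha> = \<nu>" for \<alpha>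
  proof
    assume *: "mset \<alpha> = \<nu> + replicate_mset (length xs - size \<nu>) 0"
    have "length \<alpha> = length xs" using True arg_cong[OF *, of size] by simp
    moreover have "filter_mset (\<lambda>a. a \<noteq> 0) \<nu> = \<nu>"
      using \<nu>(1) by (induction \<nu>) auto
    then have "positive_parts \<alpha> = \<nu>"
      by (simp add: positive_parts_def *)
    ultimately show "length \<alpha> = length xs \<and> sum_list \<alpha> = n \<and> positive_parts \<alpha> = \<nu>"
      using \<nu>(2) sum_positive_parts[of \<alpha>] by simp
  next
    assume *: "length \<alpha> = length xs \<and> sum_list \<alpha> = n \<and> positive_parts \<alpha> = \<nu>"
    have split: "mset \<alpha> = filter_mset (\<lambda>a. a \<noteq> 0) (mset \<alpha>) + filter_mset (\<lambda>a. \<not> a \<noteq> 0) (mset \<alpha>)"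
      by (rule multiset_partition)
    have z: "filter_mset (\<lambda>a. \<not> a \<noteq> 0) (mset \<alpha>) = replicate_mset (count (mset \<alpha>) 0) 0"
      using filter_eq_replicate_mset[of 0 "mset \<alpha>"] by (simp add: eq_commute)
    have "length \<alpha> = size \<nu> + count (mset \<alpha>) 0"
      using arg_cong[OF split, of size] * unfolding z by (simp add: positive_parts_def)
    then show "mset \<alpha> = \<nu> + replicate_mset (length xs - size \<nu>) 0"
      using split * unfolding z by (simp add: positive_parts_def)
  qed
  then show ?thesis
    using True by (auto simp: monomial_sym_def permutations_of_multiset_def weak_compositions_def intro!: sum.cong)
next
  case False
  then have "positive_parts \<alpha> \<noteq> \<nu>" if "\<alpha> \<in> weak_compositions (length xs) n" for \<alpha>
    using size_positive_parts_le[of \<alpha>] that by (auto simp: weak_compositions_def)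
  then have empty: "{\<alpha> \<in> weak_compositions (length xs) n. positive_parts \<alpha> = \<nu>} = {}" by blast
  show ?thesis unfolding empty using False by (simp add: monomial_sym_def)
qed

text \<open>The Taylor coefficients of z times the logarithmic derivative of \<open>Lambda\<close>
  at z, when \<open>p\<close> lists the power traces of the inverse matrix.\<close>

definition log_coeff :: "nat \<Rightarrow> (nat \<Rightarrow> complex) \<Rightarrow> nat \<Rightarrow> complex" where
  "log_coeff N p n = (if n = 0 then - of_nat N / 2 else - p n)"

text \<open>What remains of a product of such coefficients once the traces are taken out: every zero
  entry leaves \<open>- N / 2\<close> and every positive one a sign.\<close>

definition sign_weight :: "nat \<Rightarrow> nat list \<Rightarrow> complex" where
  "sign_weight N \<alpha> = (- of_nat N / 2) ^ (length \<alpha> - size (positive_parts \<alpha>)) * (-1) ^ size (positive_parts \<alpha>)"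

lemma prod_log_coeff:
  "(\<Prod>i<length \<alpha>. log_coeff N p (\<alpha> ! i)) = sign_weight N \<alpha> * (\<Prod>a\<in>#positive_parts \<alpha>. p a)"
proof (induction \<alpha>)
  case Nil
  then show ?case by (simp add: sign_weight_def positive_parts_def)
next
  case (Cons a \<alpha>)
  have "sign_weight N (a # \<alpha>) * (\<Prod>a\<in>#positive_parts (a # \<alpha>). p a) =
      log_coeff N p a * (sign_weight N \<alpha> * (\<Prod>a\<in>#positive_parts \<alpha>. p a))"
    using size_positive_parts_le[of \<alpha>]
    by (auto simp: log_coeff_def sign_weight_def positive_parts_def Suc_diff_le mult_ac)
  then show ?case unfolding length_Cons prod.lessThan_Suc_shift using Cons.IH by simp
qed

lemma norm_sign_weight_le: "N \<ge> 1 \<Longrightarrow> norm (sign_weight N \<alpha>) \<le> real N ^ length \<alpha>"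
proof -
  assume N: "N \<ge> 1"
  have "norm (sign_weight N \<alpha>) = (real N / 2) ^ (length \<alpha> - size (positive_parts \<alpha>))"
    by (simp add: sign_weight_def norm_mult norm_power norm_divide)
  also have "\<dots> \<le> real N ^ (length \<alpha> - size (positive_parts \<alpha>))"
    by (intro power_mono) auto
  also have "\<dots> \<le> real N ^ length \<alpha>"
    using N by (intro power_increasing) auto
  finally show ?thesis .
qed

lemma norm_log_coeff_le: "(\<And>n. norm (p n) \<le> real N) \<Longrightarrow> norm (log_coeff N p n) \<le> real N"
  by (simp add: log_coeff_def norm_divide)

text \<open>The exponent is an integer because twice the size of \<open>\<nu>\<close> may exceed the
  total length of the lists; one of the monomial functions then vanishes.\<close>

definition partition_summand :: "nat \<Rightarrow> complex list \<Rightarrow> complex list \<Rightarrow> nat multiset \<Rightarrow> complex" where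
  "partition_summand N E F \<nu> =
     (- of_nat N / 2) powi (int (length E) + int (length F) - 2 * int (size \<nu>)) *
       of_nat (z_part \<nu>) * monomial_sym \<nu> E * monomial_sym \<nu> F"

definition composition_term ::
  "nat \<Rightarrow> complex list \<Rightarrow> complex list \<Rightarrow> nat list \<Rightarrow> nat list \<Rightarrow> complex" where
  "composition_term N E F \<alpha> \<beta> = (sign_weight N \<alpha> * (\<Prod>i<length E. E ! i ^ (\<alpha> ! i))) *
     (sign_weight N \<beta> * (\<Prod>i<length F. F ! i ^ (\<beta> ! i)))"

text \<open>Two compositions with the same positive parts carry equally many signs, so these cancel,
  and the number of their zero entries together is the exponent in
  \<open>partition_summand\<close>.\<close>

lemma partition_summand_eq:
  assumes \<nu>: "0 \<notin># \<nu>" "sum_mset \<nu> = n"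
  shows "partition_summand N E F \<nu> =
    (\<Sum>\<alpha>\<in>{\<alpha> \<in> weak_compositions (length E) n. positive_parts \<alpha> = \<nu>}.
       \<Sum>\<beta>\<in>weak_compositions (length F) n. composition_term N E F \<alpha> \<beta> * gram (positive_parts \<beta>) (positive_parts \<alpha>))"
    (is "_ = (\<Sum>\<alpha>\<in>?A. ?R \<alpha>)")
proof -
  let ?B = "{\<beta> \<in> weak_compositions (length F) n. positive_parts \<beta> = \<nu>}"
  let ?w = "(- of_nat N / 2) powi (int (length E) + int (length F) - 2 * int (size \<nu>)) * of_nat (z_part \<nu>) :: complex"
  have "partition_summand N E F \<nu> = ?w *
      ((\<Sum>\<alpha>\<in>?A. \<Prod>i<length E. E ! i ^ (\<alpha> ! i)) * (\<Sum>\<beta>\<in>?B. \<Prod>i<length F. F ! i ^ (\<beta> ! i)))"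
    by (simp only: partition_summand_def monomial_sym_eq[OF \<nu>] mult.assoc)
  also have "\<dots> = (\<Sum>\<alpha>\<in>?A. \<Sum>\<beta>\<in>?B. ?w * ((\<Prod>i<length E. E ! i ^ (\<alpha> ! i)) * (\<Prod>i<length F. F ! i ^ (\<beta> ! i))))"
    unfolding sum_product unfolding sum_distrib_left ..
  also have "\<dots> = (\<Sum>\<alpha>\<in>?A. ?R \<alpha>)"
  proof (rule sum.cong[OF refl])
    fix \<alpha> assume \<alpha>: "\<alpha> \<in> ?A"
    then have sa: "size \<nu> \<le> length E" using size_positive_parts_le[of \<alpha>] by (auto simp: weak_compositions_def)
    have "?R \<alpha> = (\<Sum>\<beta>\<in>?B. composition_term N E F \<alpha> \<beta> * gram (positive_parts \<beta>) (positive_parts \<alpha>))"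
      using \<alpha> by (intro sum.mono_neutral_right) (auto simp: gram_def)
    also have "\<dots> = (\<Sum>\<beta>\<in>?B. ?w * ((\<Prod>i<length E. E ! i ^ (\<alpha> ! i)) * (\<Prod>i<length F. F ! i ^ (\<beta> ! i))))"
    proof (rule sum.cong[OF refl])
      fix \<beta> assume \<beta>: "\<beta> \<in> ?B"
      then have sb: "size \<nu> \<le> length F" using size_positive_parts_le[of \<beta>] by (auto simp: weak_compositions_def)
      have "int (length E) + int (length F) - 2 * int (size \<nu>) =
          int ((length E - size \<nu>) + (length F - size \<nu>))"
        using sa sb by (simp add: of_nat_diff)
      then have "(- of_nat N / 2) powi (int (length E) + int (length F) - 2 * int (size \<nu>)) =
          (- of_nat N / 2 :: complex) ^ (length E - size \<nu>) * (- of_nat N / 2) ^ (length F - size \<nu>)"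
        by (simp only: power_int_of_nat power_add)
      moreover have "sign_weight N \<alpha> * sign_weight N \<beta> =
          (- of_nat N / 2) ^ (length E - size \<nu>) * (- of_nat N / 2) ^ (length F - size \<nu>)"
      proof -
        have "(-1 :: complex) ^ size \<nu> * (-1) ^ size \<nu> = 1"
          by (simp flip: power_mult_distrib)
        then show ?thesis
          using \<alpha> \<beta> by (simp add: sign_weight_def weak_compositions_def mult_ac)
      qed
      ultimately have "?w = sign_weight N \<alpha> * sign_weight N \<beta> * gram (positive_parts \<beta>) (positive_parts \<alpha>)"
        using \<alpha> \<beta> by (simp add: gram_def)
      then show "composition_term N E F \<alpha> \<beta> * gram (positive_parts \<beta>) (positive_parts \<alpha>) =
          ?w * ((\<Prod>i<length E. E ! i ^ (\<alpha> ! i)) * (\<Prod>i<length F. F ! i ^ (\<beta> ! i)))"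
        by (simp only: composition_term_def mult_ac)
    qed
    finally show "(\<Sum>\<beta>\<in>?B. ?w * ((\<Prod>i<length E. E ! i ^ (\<alpha> ! i)) * (\<Prod>i<length F. F ! i ^ (\<beta> ! i)))) = ?R \<alpha>" ..
  qed
  finally show ?thesis .
qed

text \<open>The right side has the shape of an integrated term of degree \<open>n\<close> with
  \<open>gram\<close> in place of \<open>moment\<close>, so matching the two sides of the asymptotic
  formula reduces to matching these covariances.\<close>

lemma sum_partition_summand:
  "(\<Sum>\<nu> | 0 \<notin># \<nu> \<and> sum_mset \<nu> = n. partition_summand N E F \<nu>) =
    (\<Sum>\<alpha>\<in>weak_compositions (length E) n. \<Sum>\<beta>\<in>weak_compositions (length F) n.
      composition_term N E F \<alpha> \<beta> * gram (positive_parts \<beta>) (positive_parts \<alpha>))"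
proof -
  have "(\<Sum>\<nu> | 0 \<notin># \<nu> \<and> sum_mset \<nu> = n. partition_summand N E F \<nu>) =
    (\<Sum>\<nu> | 0 \<notin># \<nu> \<and> sum_mset \<nu> = n. \<Sum>\<alpha>\<in>{\<alpha> \<in> weak_compositions (length E) n. positive_parts \<alpha> = \<nu>}.
       \<Sum>\<beta>\<in>weak_compositions (length F) n. composition_term N E F \<alpha> \<beta> * gram (positive_parts \<beta>) (positive_parts \<alpha>))"
    by (intro sum.cong refl partition_summand_eq) auto
  also have "\<dots> = (\<Sum>\<alpha>\<in>weak_compositions (length E) n. \<Sum>\<beta>\<in>weak_compositions (length F) n.
      composition_term N E F \<alpha> \<beta> * gram (positive_parts \<beta>) (positive_parts \<alpha>))"
    by (rule sum.group[OF finite_weak_compositions finite_partitions_of])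
      (auto simp: zero_notin_positive_parts sum_positive_parts weak_compositions_def)
  finally show ?thesis .
qed

text \<open>Norms are summed individually with a view to absolute summability over all partitions.
  One power of \<open>n + 1\<close> for each entry of either list counts compositions; another
  \<open>length E\<close> of them, with the factorial, bound \<open>z_part\<close>, as a
  contributing partition has at most that many parts.\<close>

lemma norm_partition_summand_sum_le:
  assumes N: "N \<ge> 1" and r: "0 \<le> r"
    and E: "\<And>e. e \<in> set E \<Longrightarrow> norm e \<le> r" and F: "\<And>f. f \<in> set F \<Longrightarrow> norm f \<le> r"
  shows "(\<Sum>\<nu> | 0 \<notin># \<nu> \<and> sum_mset \<nu> = n. norm (partition_summand N E F \<nu>)) \<le>
    fact (length E) * real N ^ (length E + length F) * real (n + 1) ^ (2 * length E + length F) * r ^ (2 * n)"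
proof -
  let ?k = "length E" and ?l = "length F"
  let ?T = "fact ?k * real N ^ (?k + ?l) * real (n + 1) ^ ?k * r ^ (2 * n)"
  let ?t = "\<lambda>\<alpha> \<beta>. composition_term N E F \<alpha> \<beta> * gram (positive_parts \<beta>) (positive_parts \<alpha>)"
  have mono: "norm (\<Prod>i<length xs. xs ! i ^ (\<alpha> ! i)) \<le> r ^ n"
    if "\<And>x. x \<in> set xs \<Longrightarrow> norm x \<le> r" "\<alpha> \<in> weak_compositions (length xs) n" for xs :: "complex list" and \<alpha>
    using norm_composition_term_le[of "\<lambda>_. 1" 1 xs r \<alpha> n] that r by simp
  have le: "norm (?t \<alpha> \<beta>) \<le> ?T"
    if \<alpha>: "\<alpha> \<in> weak_compositions ?k n" and \<beta>: "\<beta> \<in> weak_compositions ?l n" for \<alpha> \<beta>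
  proof -
    have "norm (composition_term N E F \<alpha> \<beta>) \<le> (real N ^ ?k * r ^ n) * (real N ^ ?l * r ^ n)"
      unfolding composition_term_def norm_mult
      using norm_sign_weight_le[OF N, of \<alpha>] norm_sign_weight_le[OF N, of \<beta>] \<alpha> \<beta> r
      by (intro mult_mono mono E F) (auto simp: weak_compositions_def)
    moreover have "norm (gram (positive_parts \<beta>) (positive_parts \<alpha>)) \<le> real (n + 1) ^ ?k * fact ?k"
    proof (cases "positive_parts \<beta> = positive_parts \<alpha>")
      case True
      have len: "length \<alpha> = ?k" "sum_list \<alpha> = n" using \<alpha> by (auto simp: weak_compositions_def)
      have "z_part (positive_parts \<alpha>) \<le> n ^ size (positive_parts \<alpha>) * fact (size (positive_parts \<alpha>))"
        using z_part_le[of "positive_parts \<alpha>"] len by (simp add: sum_positive_parts)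
      also have "\<dots> \<le> (n + 1) ^ size (positive_parts \<alpha>) * fact (size (positive_parts \<alpha>))"
        by (intro mult_right_mono power_mono) auto
      also have "\<dots> \<le> (n + 1) ^ ?k * fact ?k"
        using size_positive_parts_le[of \<alpha>] len by (intro mult_mono power_increasing fact_mono) auto
      finally have "real (z_part (positive_parts \<alpha>)) \<le> real ((n + 1) ^ ?k * fact ?k)"
        by (rule of_nat_mono)
      then show ?thesis using True by (simp add: gram_def)
    qed (simp add: gram_def)
    ultimately have "norm (?t \<alpha> \<beta>) \<le>
        (real N ^ ?k * r ^ n) * (real N ^ ?l * r ^ n) * (real (n + 1) ^ ?k * fact ?k)"
      unfolding norm_mult using r by (intro mult_mono) auto
    also have "\<dots> = ?T"
      unfolding mult_2 power_add by (simp only: mult_ac)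
    finally show ?thesis .
  qed
  have "(\<Sum>\<nu> | 0 \<notin># \<nu> \<and> sum_mset \<nu> = n. norm (partition_summand N E F \<nu>)) \<le>
      (\<Sum>\<nu> | 0 \<notin># \<nu> \<and> sum_mset \<nu> = n. \<Sum>\<alpha>\<in>{\<alpha> \<in> weak_compositions ?k n. positive_parts \<alpha> = \<nu>}.
        \<Sum>\<beta>\<in>weak_compositions ?l n. norm (?t \<alpha> \<beta>))"
  proof (rule sum_mono)
    fix \<nu> assume "\<nu> \<in> {\<nu>. 0 \<notin># \<nu> \<and> sum_mset \<nu> = n}"
    then have \<nu>: "0 \<notin># \<nu>" "sum_mset \<nu> = n" by auto
    show "norm (partition_summand N E F \<nu>) \<le>
        (\<Sum>\<alpha>\<in>{\<alpha> \<in> weak_compositions ?k n. positive_parts \<alpha> = \<nu>}. \<Sum>\<beta>\<in>weak_compositions ?l n. norm (?t \<alpha> \<beta>))"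
      unfolding partition_summand_eq[OF \<nu>] by (intro order.trans[OF norm_sum] sum_mono norm_sum)
  qed
  also have "\<dots> = (\<Sum>\<alpha>\<in>weak_compositions ?k n. \<Sum>\<beta>\<in>weak_compositions ?l n. norm (?t \<alpha> \<beta>))"
    by (rule sum.group[OF finite_weak_compositions finite_partitions_of])
      (auto simp: zero_notin_positive_parts sum_positive_parts weak_compositions_def)
  also have "\<dots> \<le> (\<Sum>\<alpha>\<in>weak_compositions ?k n. \<Sum>\<beta>\<in>weak_compositions ?l n. ?T)"
    by (intro sum_mono le)
  also have "\<dots> = real (card (weak_compositions ?k n)) * real (card (weak_compositions ?l n)) * ?T"
    by simp
  also have "\<dots> \<le> real ((n + 1) ^ ?k) * real ((n + 1) ^ ?l) * ?T"
    using card_weak_compositions_le r by (intro mult_mono of_nat_mono) auto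
  also have "\<dots> = fact ?k * real N ^ (?k + ?l) * real (n + 1) ^ (2 * ?k + ?l) * r ^ (2 * n)"
    unfolding mult_2 power_add of_nat_power by (simp only: mult_ac)
  finally show ?thesis .
qed

section \<open>The asymptotic formula\<close>

lemma mat_adjoint_pow:
  assumes "(g :: complex mat) \<in> carrier_mat n n"
  shows "mat_adjoint g ^\<^sub>m a = mat_adjoint (g ^\<^sub>m a)"
proof (induction a)
  case 0
  then show ?case using assms mat_adjoint_carrier[OF assms] by (simp add: mat_adjoint_one)
next
  case (Suc a)
  have "g ^\<^sub>m Suc a = g * g ^\<^sub>m a"
    using pow_mat_add[OF assms, of 1 a] assms by simp
  then have "mat_adjoint (g ^\<^sub>m Suc a) = mat_adjoint (g ^\<^sub>m a) * mat_adjoint g"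
    using mat_adjoint_mult[OF assms pow_carrier_mat[OF assms]] by simp
  then show ?case using Suc by simp
qed

lemma mat_trace_adjoint_pow:
  assumes "(g :: complex mat) \<in> carrier_mat n n"
  shows "mat_trace (mat_adjoint g ^\<^sub>m a) = cnj (mat_trace (g ^\<^sub>m a))"
  unfolding mat_adjoint_pow[OF assms]
  using assms mat_adjoint_carrier[OF pow_carrier_mat[OF assms, of a]]
  by (simp add: mat_trace_def mat_adjoint_index[OF pow_carrier_mat[OF assms]])

lemma cnj_power_sum: "cnj (power_sum \<kappa> g) = (\<Prod>a\<in>#\<kappa>. cnj (mat_trace (g ^\<^sub>m a)))"
  by (induction \<kappa>) simp_all

text \<open>Multiplication by z turns the pole of the logarithmic derivative at 0 into the constant
  coefficient.\<close>

lemma Lambda_logderiv_sums: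
  assumes g: "g \<in> carrier (unitary_group N)" and z: "z \<noteq> 0" "norm z < 1"
  shows "(\<lambda>n. log_coeff N (\<lambda>a. mat_trace (inv\<^bsub>unitary_group N\<^esub> g ^\<^sub>m a)) n * z ^ n) sums (z * Lambda_logderiv N g z)"
proof -
  let ?f = "\<lambda>n. log_coeff N (\<lambda>a. mat_trace (inv\<^bsub>unitary_group N\<^esub> g ^\<^sub>m a)) n * z ^ n"
  have "(\<lambda>n. ?f (Suc n)) sums (z * (deriv (chi N g) z / chi N g z))"
    using chi_logderiv_sums[OF g refl z(2)] by (simp add: log_coeff_def mult.commute del: pow_mat.simps power_Suc)
  then have "?f sums (z * (deriv (chi N g) z / chi N g z) + ?f 0)"
    by (rule sums_Suc)
  also have "z * (deriv (chi N g) z / chi N g z) + ?f 0 = z * Lambda_logderiv N g z"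
    using z by (simp add: Lambda_logderiv_def log_coeff_def distrib_left right_diff_distrib)
  finally show ?thesis .
qed

lemma composition_sum_log_coeff:
  "composition_sum (log_coeff N p) E n = (\<Sum>\<alpha>\<in>weak_compositions (length E) n.
     (sign_weight N \<alpha> * (\<Prod>i<length E. E ! i ^ (\<alpha> ! i))) * (\<Prod>a\<in>#positive_parts \<alpha>. p a))"
  unfolding composition_sum_def prod.distrib
proof (intro sum.cong refl)
  fix \<alpha> assume "\<alpha> \<in> weak_compositions (length E) n"
  then have "length \<alpha> = length E" by (simp add: weak_compositions_def)
  then show "(\<Prod>i<length E. log_coeff N p (\<alpha> ! i)) * (\<Prod>i<length E. E ! i ^ (\<alpha> ! i)) =
      (sign_weight N \<alpha> * (\<Prod>i<length E. E ! i ^ (\<alpha> ! i))) * (\<Prod>a\<in>#positive_parts \<alpha>. p a)"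
    using prod_log_coeff[where N = N and p = p and \<alpha> = \<alpha>] by (simp add: mult_ac)
qed

text \<open>The degree cuts the partitions into finite blocks; absolute convergence permits passing
  from the unordered sum to a series over the degree.\<close>

lemma partition_summand_summable:
  assumes N: "N \<ge> 1" and r: "0 \<le> r" "r < 1"
    and E: "\<And>e. e \<in> set E \<Longrightarrow> norm e \<le> r" and F: "\<And>f. f \<in> set F \<Longrightarrow> norm f \<le> r"
  shows "partition_summand N E F summable_on partitions"
    and "(\<lambda>n. \<Sum>\<nu> | 0 \<notin># \<nu> \<and> sum_mset \<nu> = n. partition_summand N E F \<nu>) sums infsum (partition_summand N E F) partitions"
proof -
  let ?f = "partition_summand N E F"
  let ?T = "\<lambda>n. {\<nu>. 0 \<notin># \<nu> \<and> sum_mset \<nu> = n} :: nat multiset set"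
  define B where "B n = fact (length E) * real N ^ (length E + length F) *
      (real (n + 1) ^ (2 * length E + length F) * (r\<^sup>2) ^ n)" for n
  have r2: "0 \<le> r\<^sup>2" "r\<^sup>2 < 1" using r by (auto simp: power_less_one_iff abs_square_less_1)
  have B: "summable B"
    unfolding B_def[abs_def] by (intro summable_mult summable_poly_geometric r2)
  have le: "(\<Sum>\<nu>\<in>?T n. norm (?f \<nu>)) \<le> B n" for n
    using norm_partition_summand_sum_le[OF N r(1) E F, where n = n]
    by (simp add: B_def power_mult mult.assoc)
  have fin: "finite (?T n)" for n by (rule finite_partitions_of)
  \<comment> \<open>Tagging each partition with its degree is a bijection onto a dependent sum,
    where iterated summation applies.\<close>
  have img: "snd ` (SIGMA n:UNIV. ?T n) = partitions"
    by (force simp: partitions_def)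
  have inj: "inj_on snd (SIGMA n:UNIV. ?T n)"
    by (auto simp: inj_on_def)
  have summ: "summable (\<lambda>n. \<Sum>\<nu>\<in>?T n. norm (?f \<nu>))"
    by (rule summable_comparison_test'[OF B, of 0]) (use le in \<open>auto simp: sum_nonneg\<close>)
  have "(\<lambda>n. norm (\<Sum>\<nu>\<in>?T n. norm (?f \<nu>))) summable_on UNIV"
    using norm_summable_imp_summable_on[of "\<lambda>n. norm (\<Sum>\<nu>\<in>?T n. norm (?f \<nu>))"] summ
    by (simp add: sum_nonneg)
  then have abs: "(\<lambda>x. norm ((?f \<circ> snd) x)) summable_on (SIGMA n:UNIV. ?T n)"
    unfolding Infinite_Sum.abs_summable_on_Sigma_iff using fin by simp
  then have sm: "(?f \<circ> snd) summable_on (SIGMA n:UNIV. ?T n)" by (rule Infinite_Sum.abs_summable_summable)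
  then show "?f summable_on partitions"
    unfolding img[symmetric] summable_on_reindex[OF inj] .
  have "infsum ?f partitions = infsum (?f \<circ> snd) (SIGMA n:UNIV. ?T n)"
    unfolding img[symmetric] by (rule infsum_reindex[OF inj])
  also have "\<dots> = infsum (\<lambda>n. infsum (\<lambda>\<nu>. (?f \<circ> snd) (n, \<nu>)) (?T n)) UNIV"
    by (rule infsum_Sigma_banach[OF sm, symmetric])
  also have "\<dots> = infsum (\<lambda>n. \<Sum>\<nu>\<in>?T n. ?f \<nu>) UNIV"
    using fin by simp
  finally have inf: "infsum ?f partitions = infsum (\<lambda>n. \<Sum>\<nu>\<in>?T n. ?f \<nu>) UNIV" .
  have "summable (\<lambda>n. norm (\<Sum>\<nu>\<in>?T n. ?f \<nu>))"
    by (rule summable_comparison_test'[OF summ, of 0]) (auto intro: norm_sum)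
  from norm_summable_imp_summable_on[OF this]
  have "((\<lambda>n. \<Sum>\<nu>\<in>?T n. ?f \<nu>) has_sum infsum ?f partitions) UNIV"
    unfolding inf by (rule has_sum_infsum)
  then show "(\<lambda>n. \<Sum>\<nu>\<in>?T n. ?f \<nu>) sums infsum ?f partitions"
    by (rule has_sum_imp_sums)
qed

section \<open>Term-by-term integration\<close>

context haar_unitary
begin

text \<open>Conjugate traces occur here since \<open>chi\<close> involves the inverse of
  \<open>g\<close>, which is its adjoint; the factors at the inverse of \<open>g\<close> lead to
  \<open>right_coeff\<close>.\<close>

definition left_coeff :: "complex list \<Rightarrow> nat \<Rightarrow> complex mat \<Rightarrow> complex" where
  "left_coeff E n g = composition_sum (log_coeff N (\<lambda>a. cnj (mat_trace (g ^\<^sub>m a)))) E n"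

definition right_coeff :: "complex list \<Rightarrow> nat \<Rightarrow> complex mat \<Rightarrow> complex" where
  "right_coeff F n g = composition_sum (log_coeff N (\<lambda>a. mat_trace (g ^\<^sub>m a))) F n"

lemma left_coeff_eq:
  "left_coeff E n g = (\<Sum>\<alpha>\<in>weak_compositions (length E) n.
     (sign_weight N \<alpha> * (\<Prod>i<length E. E ! i ^ (\<alpha> ! i))) * cnj (power_sum (positive_parts \<alpha>) g))"
  unfolding left_coeff_def composition_sum_log_coeff cnj_power_sum ..

lemma right_coeff_eq:
  "right_coeff F n g = (\<Sum>\<beta>\<in>weak_compositions (length F) n.
     (sign_weight N \<beta> * (\<Prod>i<length F. F ! i ^ (\<beta> ! i))) * power_sum (positive_parts \<beta>) g)"
  unfolding right_coeff_def composition_sum_log_coeff power_sum_def ..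

lemma bounded_meas_left_coeff: "bounded_meas (left_coeff E n)"
  unfolding left_coeff_eq[abs_def]
  by (intro bounded_meas_sum bounded_meas_mult[OF bounded_meas_const] bounded_meas_cnj bounded_meas_power_sum)

lemma bounded_meas_right_coeff: "bounded_meas (right_coeff F n)"
  unfolding right_coeff_eq[abs_def]
  by (intro bounded_meas_sum bounded_meas_mult[OF bounded_meas_const] bounded_meas_power_sum)

lemma norm_left_coeff_le:
  assumes "g \<in> U" "\<And>e. e \<in> set E \<Longrightarrow> norm e \<le> r" "0 \<le> r"
  shows "norm (left_coeff E n g) \<le> real N ^ length E * (real (n + 1) ^ length E * r ^ n)"
proof -
  have "norm (log_coeff N (\<lambda>a. cnj (mat_trace (g ^\<^sub>m a))) m) \<le> real N" for m
    by (rule norm_log_coeff_le) (simp add: norm_trace_unitary_pow_le[OF assms(1)])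
  from norm_composition_sum_le[OF this assms(2,3), where n = n] show ?thesis
    by (simp add: left_coeff_def mult_ac)
qed

lemma norm_right_coeff_le:
  assumes "g \<in> U" "\<And>e. e \<in> set F \<Longrightarrow> norm e \<le> r" "0 \<le> r"
  shows "norm (right_coeff F n g) \<le> real N ^ length F * (real (n + 1) ^ length F * r ^ n)"
proof -
  have "norm (log_coeff N (\<lambda>a. mat_trace (g ^\<^sub>m a)) m) \<le> real N" for m
    by (rule norm_log_coeff_le) (simp add: norm_trace_unitary_pow_le[OF assms(1)])
  from norm_composition_sum_le[OF this assms(2,3), where n = n] show ?thesis
    by (simp add: right_coeff_def mult_ac)
qed

lemma left_coeff_sums:
  assumes g: "g \<in> U" and E: "\<And>e. e \<in> set E \<Longrightarrow> e \<noteq> 0 \<and> norm e \<le> r" and r: "0 \<le> r" "r < 1"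
  shows "(\<lambda>n. left_coeff E n g) sums (\<Prod>e\<leftarrow>E. e * Lambda_logderiv N g e)"
  unfolding left_coeff_def
proof (rule composition_sum_sums[where K = "real N" and r = r])
  show "norm (log_coeff N (\<lambda>a. cnj (mat_trace (g ^\<^sub>m a))) m) \<le> real N" for m
    by (rule norm_log_coeff_le) (simp add: norm_trace_unitary_pow_le[OF g])
  fix e assume "e \<in> set E"
  then have "e \<noteq> 0" "norm e < 1" using E r by (auto intro: le_less_trans)
  from Lambda_logderiv_sums[OF g this]
  show "(\<lambda>n. log_coeff N (\<lambda>a. cnj (mat_trace (g ^\<^sub>m a))) n * e ^ n) sums (e * Lambda_logderiv N g e)"
    by (simp add: inv_unitary_group[OF g] mat_trace_adjoint_pow[OF U_carrier[OF g]])
qed (use E r in auto)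

lemma right_coeff_sums:
  assumes g: "g \<in> U" and F: "\<And>f. f \<in> set F \<Longrightarrow> f \<noteq> 0 \<and> norm f \<le> r" and r: "0 \<le> r" "r < 1"
  shows "(\<lambda>n. right_coeff F n g) sums (\<Prod>f\<leftarrow>F. f * Lambda_logderiv N (inv\<^bsub>unitary_group N\<^esub> g) f)"
  unfolding right_coeff_def
proof (rule composition_sum_sums[where K = "real N" and r = r])
  show "norm (log_coeff N (\<lambda>a. mat_trace (g ^\<^sub>m a)) m) \<le> real N" for m
    by (rule norm_log_coeff_le) (simp add: norm_trace_unitary_pow_le[OF g])
  fix f assume "f \<in> set F"
  then have f: "f \<noteq> 0" "norm f < 1" using F r by (auto intro: le_less_trans)
  have "inv\<^bsub>unitary_group N\<^esub> g \<in> U" "inv\<^bsub>unitary_group N\<^esub> (inv\<^bsub>unitary_group N\<^esub> g) = g"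
    using group.inv_closed[OF group_unitary_group g] group.inv_inv[OF group_unitary_group g] by auto
  with Lambda_logderiv_sums[OF _ f, of "inv\<^bsub>unitary_group N\<^esub> g" N]
  show "(\<lambda>n. log_coeff N (\<lambda>a. mat_trace (g ^\<^sub>m a)) n * f ^ n) sums
      (f * Lambda_logderiv N (inv\<^bsub>unitary_group N\<^esub> g) f)"
    by simp
qed (use F r in auto)

lemma integral_left_right_coeff:
  "(LINT g|\<mu>. left_coeff E n g * right_coeff F m g) =
    (\<Sum>\<alpha>\<in>weak_compositions (length E) n. \<Sum>\<beta>\<in>weak_compositions (length F) m.
      composition_term N E F \<alpha> \<beta> * moment (positive_parts \<beta>) (positive_parts \<alpha>))"
proof -
  let ?h = "\<lambda>\<alpha> \<beta> g. composition_term N E F \<alpha> \<beta> *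
    (power_sum (positive_parts \<beta>) g * cnj (power_sum (positive_parts \<alpha>) g))"
  have int: "integrable \<mu> (?h \<alpha> \<beta>)" for \<alpha> \<beta>
    by (intro bounded_meas_integrable bounded_meas_mult[OF bounded_meas_const] bounded_meas_moment)
  have "left_coeff E n g * right_coeff F m g =
      (\<Sum>\<alpha>\<in>weak_compositions (length E) n. \<Sum>\<beta>\<in>weak_compositions (length F) m. ?h \<alpha> \<beta> g)" for g
    unfolding left_coeff_eq right_coeff_eq sum_product composition_term_def
    by (intro sum.cong refl) (simp only: mult_ac)
  then have "(LINT g|\<mu>. left_coeff E n g * right_coeff F m g) =
      (LINT g|\<mu>. (\<Sum>\<alpha>\<in>weak_compositions (length E) n. \<Sum>\<beta>\<in>weak_compositions (length F) m. ?h \<alpha> \<beta> g))"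
    by simp
  also have "\<dots> = (\<Sum>\<alpha>\<in>weak_compositions (length E) n.
      (LINT g|\<mu>. (\<Sum>\<beta>\<in>weak_compositions (length F) m. ?h \<alpha> \<beta> g)))"
    by (intro Bochner_Integration.integral_sum Bochner_Integration.integrable_sum int)
  also have "\<dots> = (\<Sum>\<alpha>\<in>weak_compositions (length E) n.
      \<Sum>\<beta>\<in>weak_compositions (length F) m. (LINT g|\<mu>. ?h \<alpha> \<beta> g))"
    by (intro sum.cong[OF refl] Bochner_Integration.integral_sum int)
  finally show ?thesis by (simp add: moment_def)
qed

lemma integral_coeff_off_diagonal:
  assumes "n \<noteq> m"
  shows "(LINT g|\<mu>. left_coeff E n g * right_coeff F m g) = 0"
  unfolding integral_left_right_coeff
proof (intro sum.neutral ballI)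
  fix \<alpha> \<beta> assume "\<alpha> \<in> weak_compositions (length E) n" "\<beta> \<in> weak_compositions (length F) m"
  then have "sum_mset (positive_parts \<beta>) \<noteq> sum_mset (positive_parts \<alpha>)"
    using assms by (simp add: weak_compositions_def sum_positive_parts)
  then show "composition_term N E F \<alpha> \<beta> * moment (positive_parts \<beta>) (positive_parts \<alpha>) = 0"
    using moment_eq_0_of_degree_neq by simp
qed

lemma integral_coeff_diagonal:
  assumes "n \<le> N"
  shows "(LINT g|\<mu>. left_coeff E n g * right_coeff F n g) =
    (\<Sum>\<nu> | 0 \<notin># \<nu> \<and> sum_mset \<nu> = n. partition_summand N E F \<nu>)"
  unfolding integral_left_right_coeff sum_partition_summand
proof (intro sum.cong refl)
  fix \<alpha> \<beta> assume "\<alpha> \<in> weak_compositions (length E) n" "\<beta> \<in> weak_compositions (length F) n"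
  then have "moment (positive_parts \<beta>) (positive_parts \<alpha>) = gram (positive_parts \<beta>) (positive_parts \<alpha>)"
    using assms
    by (intro moment_eq_gram[of _ n]) (auto simp: weak_compositions_def sum_positive_parts zero_notin_positive_parts)
  then show "composition_term N E F \<alpha> \<beta> * moment (positive_parts \<beta>) (positive_parts \<alpha>) =
      composition_term N E F \<alpha> \<beta> * gram (positive_parts \<beta>) (positive_parts \<alpha>)"
    by simp
qed

lemma norm_integral_coeff_le:
  assumes E: "\<And>e. e \<in> set E \<Longrightarrow> norm e \<le> r" and F: "\<And>f. f \<in> set F \<Longrightarrow> norm f \<le> r" and r: "0 \<le> r"
  shows "norm (LINT g|\<mu>. left_coeff E n g * right_coeff F n g) \<le>
    real N ^ (length E + length F) * real (n + 1) ^ (length E + length F) * r ^ (2 * n)"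
proof (rule integral_norm_bound_U)
  show "bounded_meas (\<lambda>g. left_coeff E n g * right_coeff F n g)"
    by (intro bounded_meas_mult bounded_meas_left_coeff bounded_meas_right_coeff)
  fix g assume g: "g \<in> U"
  have "norm (left_coeff E n g * right_coeff F n g) \<le>
      (real N ^ length E * (real (n + 1) ^ length E * r ^ n)) *
      (real N ^ length F * (real (n + 1) ^ length F * r ^ n))"
    unfolding norm_mult using r
    by (intro mult_mono norm_left_coeff_le norm_right_coeff_le g E F) auto
  also have "\<dots> = real N ^ (length E + length F) * real (n + 1) ^ (length E + length F) * r ^ (2 * n)"
    unfolding mult_2 power_add by (simp only: mult_ac)
  finally show "norm (left_coeff E n g * right_coeff F n g) \<le>
      real N ^ (length E + length F) * real (n + 1) ^ (length E + length F) * r ^ (2 * n)" .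
qed

abbreviation integrand :: "complex list \<Rightarrow> complex list \<Rightarrow> complex mat \<Rightarrow> complex" where
  "integrand E F g \<equiv> (\<Prod>e\<leftarrow>E. e * Lambda_logderiv N g e) *
     (\<Prod>f\<leftarrow>F. f * Lambda_logderiv N (inv\<^bsub>unitary_group N\<^esub> g) f)"

text \<open>Geometric decay bounds the products of partial sums uniformly on the group, so dominated
  convergence applies with a constant majorant. The double sums become diagonal because mixed
  degrees integrate to zero.\<close>

lemma integrand_expansion:
  assumes E: "\<And>e. e \<in> set E \<Longrightarrow> e \<noteq> 0 \<and> norm e \<le> r" and F: "\<And>f. f \<in> set F \<Longrightarrow> f \<noteq> 0 \<and> norm f \<le> r"
    and r: "0 \<le> r" "r < 1"
  shows "integrable \<mu> (integrand E F)"
    and "(\<lambda>n. LINT g|\<mu>. left_coeff E n g * right_coeff F n g) sums (LINT g|\<mu>. integrand E F g)"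
proof -
  define X where "X i g = (\<Sum>n<i. left_coeff E n g)" for i g
  define Y where "Y i g = (\<Sum>n<i. right_coeff F n g)" for i g
  let ?a = "\<lambda>n. real N ^ length E * (real (n + 1) ^ length E * r ^ n)"
  let ?b = "\<lambda>n. real N ^ length F * (real (n + 1) ^ length F * r ^ n)"
  have summ: "summable ?a" "summable ?b"
    by (intro summable_mult summable_poly_geometric r)+
  have nonneg: "0 \<le> ?a n" "0 \<le> ?b n" for n using r by auto
  have X_le: "norm (X i g) \<le> suminf ?a" if "g \<in> U" for i g
  proof -
    have "norm (X i g) \<le> (\<Sum>n<i. ?a n)"
      unfolding X_def using E r
      by (intro order.trans[OF norm_sum] sum_mono norm_left_coeff_le that) auto
    also have "\<dots> \<le> suminf ?a" by (intro sum_le_suminf summ) (use nonneg in auto)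
    finally show ?thesis .
  qed
  have Y_le: "norm (Y i g) \<le> suminf ?b" if "g \<in> U" for i g
  proof -
    have "norm (Y i g) \<le> (\<Sum>n<i. ?b n)"
      unfolding Y_def using F r
      by (intro order.trans[OF norm_sum] sum_mono norm_right_coeff_le that) auto
    also have "\<dots> \<le> suminf ?b" by (intro sum_le_suminf summ) (use nonneg in auto)
    finally show ?thesis .
  qed
  have lim: "(\<lambda>i. X i g * Y i g) \<longlonglongrightarrow> integrand E F g" if "g \<in> U" for g
    using left_coeff_sums[OF that E r] right_coeff_sums[OF that F r]
    unfolding X_def Y_def sums_def by (intro tendsto_mult) auto
  have bm: "bounded_meas (X i)" "bounded_meas (Y i)" for i
    unfolding X_def[abs_def] Y_def[abs_def]
    by (intro bounded_meas_sum bounded_meas_left_coeff bounded_meas_right_coeff)+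
  have meas: "(\<lambda>g. X i g * Y i g) \<in> borel_measurable \<mu>" for i
    using bounded_meas_mult[OF bm, of i i] by (simp add: bounded_meas_def)
  have meas': "integrand E F \<in> borel_measurable \<mu>"
    by (rule borel_measurable_LIMSEQ_metric[where f = "\<lambda>i g. X i g * Y i g", OF meas])
      (simp add: space_haar lim)
  have sa: "0 \<le> suminf ?a" by (intro suminf_nonneg summ nonneg)
  have dom: "norm (X i g * Y i g) \<le> suminf ?a * suminf ?b" if "g \<in> U" for i g
    unfolding norm_mult using X_le[OF that] Y_le[OF that] sa by (intro mult_mono) auto
  have AE: "AE g in \<mu>. (\<lambda>i. X i g * Y i g) \<longlonglongrightarrow> integrand E F g"
    "\<And>i. AE g in \<mu>. norm (X i g * Y i g) \<le> suminf ?a * suminf ?b"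
    using lim dom by (auto simp: space_haar)
  have int_const: "integrable \<mu> (\<lambda>g. suminf ?a * suminf ?b)" by simp
  show "integrable \<mu> (integrand E F)"
    by (rule integrable_dominated_convergence[OF meas' meas int_const AE])
  have "(\<lambda>i. LINT g|\<mu>. X i g * Y i g) \<longlonglongrightarrow> (LINT g|\<mu>. integrand E F g)"
    by (rule integral_dominated_convergence[OF meas' meas int_const AE])
  moreover have "(LINT g|\<mu>. X i g * Y i g) = (\<Sum>n<i. LINT g|\<mu>. left_coeff E n g * right_coeff F n g)" for i
  proof -
    have int: "integrable \<mu> (\<lambda>g. left_coeff E n g * right_coeff F m g)" for n m
      by (intro bounded_meas_integrable bounded_meas_mult bounded_meas_left_coeff bounded_meas_right_coeff)
    have "(LINT g|\<mu>. X i g * Y i g) =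
        (LINT g|\<mu>. (\<Sum>n<i. \<Sum>m<i. left_coeff E n g * right_coeff F m g))"
      unfolding X_def Y_def sum_product ..
    also have "\<dots> = (\<Sum>n<i. (LINT g|\<mu>. (\<Sum>m<i. left_coeff E n g * right_coeff F m g)))"
      by (intro Bochner_Integration.integral_sum Bochner_Integration.integrable_sum int)
    also have "\<dots> = (\<Sum>n<i. \<Sum>m<i. (LINT g|\<mu>. left_coeff E n g * right_coeff F m g))"
      by (intro sum.cong[OF refl] Bochner_Integration.integral_sum int)
    also have "\<dots> = (\<Sum>n<i. \<Sum>m<i. if m = n then (LINT g|\<mu>. left_coeff E n g * right_coeff F n g) else 0)"
      by (intro sum.cong refl) (simp add: integral_coeff_off_diagonal)
    also have "\<dots> = (\<Sum>n<i. LINT g|\<mu>. left_coeff E n g * right_coeff F n g)"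
      by (simp add: sum.delta)
    finally show ?thesis .
  qed
  ultimately show "(\<lambda>n. LINT g|\<mu>. left_coeff E n g * right_coeff F n g) sums (LINT g|\<mu>. integrand E F g)"
    by (simp add: sums_def)
qed

lemma integral_integrand_estimate:
  assumes N: "N \<ge> 1"
    and E: "\<And>e. e \<in> set E \<Longrightarrow> e \<noteq> 0 \<and> norm e \<le> r" and F: "\<And>f. f \<in> set F \<Longrightarrow> f \<noteq> 0 \<and> norm f \<le> r"
    and r: "0 \<le> r" "r < 1"
  shows "norm ((LINT g|\<mu>. integrand E F g) - infsum (partition_summand N E F) partitions) \<le>
    ((1 + fact (length E)) * (\<Sum>m. real (m + 3) ^ (2 * length E + length F) * (r\<^sup>2) ^ m)) *
    (r ^ (2 * N) * real N ^ (3 * length E + 2 * length F))"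
proof -
  let ?k = "length E" and ?l = "length F"
  let ?p = "2 * ?k + ?l"
  have nE: "\<And>e. e \<in> set E \<Longrightarrow> norm e \<le> r" and nF: "\<And>f. f \<in> set F \<Longrightarrow> norm f \<le> r"
    using E F by auto
  define d where "d n = (LINT g|\<mu>. left_coeff E n g * right_coeff F n g) -
    (\<Sum>\<nu> | 0 \<notin># \<nu> \<and> sum_mset \<nu> = n. partition_summand N E F \<nu>)" for n
  define D where "D = (LINT g|\<mu>. integrand E F g) - infsum (partition_summand N E F) partitions"
  have sums: "d sums D"
    unfolding d_def[abs_def] D_def
    by (intro sums_diff integrand_expansion(2)[OF E F r] partition_summand_summable(2)[OF N r nE nF])
  \<comment> \<open>Degree \<open>N\<close> itself still cancels, so the tail starts at
    \<open>N + 1\<close>.\<close>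
  have "d n = 0" if "n < Suc N" for n
    using that by (simp add: d_def integral_coeff_diagonal)
  then have shifted: "(\<lambda>m. d (m + Suc N)) sums D"
    using sums by (subst sums_iff_shift) simp
  define c where "c = (1 + fact ?k) * (r ^ (2 * N) * real N ^ (3 * ?k + 2 * ?l))"
  define s where "s m = real (m + 3) ^ ?p * (r\<^sup>2) ^ m" for m
  have r2: "0 \<le> r\<^sup>2" "r\<^sup>2 < 1" using r by (auto simp: power_less_one_iff abs_square_less_1)
  have s: "summable s"
    unfolding s_def[abs_def] by (intro summable_poly_geometric r2)
  have d_le: "norm (d (m + Suc N)) \<le> c * s m" for m
  proof -
    define n where "n = m + Suc N"
    have "norm (d n) \<le> real N ^ (?k + ?l) * real (n + 1) ^ (?k + ?l) * r ^ (2 * n)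
        + fact ?k * real N ^ (?k + ?l) * real (n + 1) ^ ?p * r ^ (2 * n)"
      unfolding d_def
      using norm_integral_coeff_le[OF nE nF r(1), where n = n]
        order.trans[OF norm_sum norm_partition_summand_sum_le[OF N r(1) nE nF, where n = n]]
      by (intro order.trans[OF norm_triangle_ineq4] add_mono)
    \<comment> \<open>The smaller exponent of \<open>n + 1\<close> is raised to the larger one, so
      that both contributions share a factor.\<close>
    also have "\<dots> \<le> real N ^ (?k + ?l) * real (n + 1) ^ ?p * r ^ (2 * n)
        + fact ?k * real N ^ (?k + ?l) * real (n + 1) ^ ?p * r ^ (2 * n)"
      using r by (intro add_right_mono mult_right_mono mult_left_mono power_increasing) auto
    also have "\<dots> = (1 + fact ?k) * real N ^ (?k + ?l) * (real (n + 1) ^ ?p * r ^ (2 * n))"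
      by (simp add: algebra_simps)
    also have "\<dots> \<le> (1 + fact ?k) * real N ^ (?k + ?l) *
        ((real N ^ ?p * real (m + 3) ^ ?p) * (r ^ (2 * N) * (r\<^sup>2) ^ m))"
    proof (intro mult_left_mono mult_mono)
      \<comment> \<open>The left side is N + m + 2. Passing to a product separates \<open>N\<close>
        from \<open>m\<close>, so the series in \<open>m\<close> does not depend on
        \<open>N\<close>.\<close>
      have "n + 1 \<le> N * (m + 3)"
        using N by (cases N) (auto simp: n_def)
      then have "real (n + 1) \<le> real N * real (m + 3)"
        unfolding of_nat_mult[symmetric] of_nat_le_iff .
      then have "real (n + 1) ^ ?p \<le> (real N * real (m + 3)) ^ ?p"
        by (intro power_mono) auto
      then show "real (n + 1) ^ ?p \<le> real N ^ ?p * real (m + 3) ^ ?p"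
        unfolding power_mult_distrib .
      have "r ^ (2 * n) \<le> r ^ (2 * N + 2 * m)"
        using r by (intro power_decreasing) (auto simp: n_def)
      then show "r ^ (2 * n) \<le> r ^ (2 * N) * (r\<^sup>2) ^ m"
        by (simp add: power_add power_mult)
    qed (use r in auto)
    also have "\<dots> = c * s m"
    proof -
      have "3 * ?k + 2 * ?l = (?k + ?l) + ?p" by simp
      then have "real N ^ (3 * ?k + 2 * ?l) = real N ^ (?k + ?l) * real N ^ ?p"
        by (simp only: power_add)
      then show ?thesis unfolding c_def s_def by (simp only: mult_ac)
    qed
    finally show ?thesis by (simp add: n_def)
  qed
  have "norm D = norm (\<Sum>m. d (m + Suc N))"
    using sums_unique[OF shifted] by simp
  also have "\<dots> \<le> (\<Sum>m. c * s m)"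
    using d_le by (intro norm_suminf_le summable_mult s)
  also have "\<dots> = c * suminf s" by (rule suminf_mult[OF s])
  finally show ?thesis unfolding D_def c_def s_def[abs_def] by (simp only: mult_ac)
qed

end

theorem mainTheorem11:
  fixes r :: real and k l :: nat
  assumes "r < 1"
  shows "\<exists>C::real. \<forall>(N::nat) (\<mu>::complex mat measure) (E::complex list) (F::complex list).
    N \<ge> 1 \<longrightarrow> normalized_haar N \<mu> \<longrightarrow> length E = k \<longrightarrow> length F = l \<longrightarrow>
    (\<forall>e\<in>set E. e \<noteq> 0 \<and> norm e \<le> r) \<longrightarrow> (\<forall>f\<in>set F. f \<noteq> 0 \<and> norm f \<le> r) \<longrightarrow>
    (let
       integrand = (\<lambda>g. (\<Prod>e\<leftarrow>E. e * Lambda_logderiv N g e) *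
                        (\<Prod>f\<leftarrow>F. f * Lambda_logderiv N (inv\<^bsub>unitary_group N\<^esub> g) f));
       summand = (\<lambda>\<nu>. (- of_nat N / 2) powi (int k + int l - 2 * int (size \<nu>)) *
                        of_nat (z_part \<nu>) * monomial_sym \<nu> E * monomial_sym \<nu> F)
     in
       integrable \<mu> integrand \<and> summand summable_on partitions \<and>
       norm ((LINT g|\<mu>. integrand g) - infsum summand partitions)
         \<le> C * (r ^ (2 * N) * real N ^ (k + l + (k - 1) + (l - 1) + (k + l - 1) + 2)))"
proof -
  \<comment> \<open>A negative \<open>r\<close> forces both lists to be empty; replacing it by 0
    keeps the estimates applicable.\<close>
  define s where "s = max 0 r"
  have s: "0 \<le> s" "s < 1" using assms by (auto simp: s_def)
  define C where "C = (1 + fact k) * (\<Sum>m. real (m + 3) ^ (2 * k + l) * (s\<^sup>2) ^ m)"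
  have s2: "0 \<le> s\<^sup>2" "s\<^sup>2 < 1" using s by (auto simp: power_less_one_iff abs_square_less_1)
  have C0: "0 \<le> C"
    unfolding C_def using s2
    by (intro mult_nonneg_nonneg suminf_nonneg summable_poly_geometric add_nonneg_nonneg) auto
  have main: "integrable \<mu> integrand \<and> summand summable_on partitions \<and>
      norm ((LINT g|\<mu>. integrand g) - infsum summand partitions)
        \<le> C * (r ^ (2 * N) * real N ^ (k + l + (k - 1) + (l - 1) + (k + l - 1) + 2))"
    if N: "N \<ge> 1" and haar: "normalized_haar N \<mu>" and len: "length E = k" "length F = l"
      and E: "\<forall>e\<in>set E. e \<noteq> 0 \<and> norm e \<le> r" and F: "\<forall>f\<in>set F. f \<noteq> 0 \<and> norm f \<le> r"
      and integrand: "integrand = (\<lambda>g. (\<Prod>e\<leftarrow>E. e * Lambda_logderiv N g e) *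
                        (\<Prod>f\<leftarrow>F. f * Lambda_logderiv N (inv\<^bsub>unitary_group N\<^esub> g) f))"
      and summand: "summand = (\<lambda>\<nu>. (- of_nat N / 2) powi (int k + int l - 2 * int (size \<nu>)) *
                        of_nat (z_part \<nu>) * monomial_sym \<nu> E * monomial_sym \<nu> F)"
    for N \<mu> E F integrand summand
  proof -
    interpret haar_unitary N \<mu> by standard (rule haar)
    have E': "\<And>e. e \<in> set E \<Longrightarrow> e \<noteq> 0 \<and> norm e \<le> s" and F': "\<And>f. f \<in> set F \<Longrightarrow> f \<noteq> 0 \<and> norm f \<le> s"
      using E F by (auto simp: s_def)
    have summand_eq: "summand = partition_summand N E F"
      unfolding summand partition_summand_def[abs_def] len ..
    let ?X = "k + l + (k - 1) + (l - 1) + (k + l - 1) + 2"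
    have "norm ((LINT g|\<mu>. integrand g) - infsum summand partitions)
        \<le> C * (s ^ (2 * N) * real N ^ (3 * k + 2 * l))"
      unfolding integrand summand_eq C_def len[symmetric]
      by (rule integral_integrand_estimate[OF N E' F' s])
    also have "\<dots> \<le> C * (r ^ (2 * N) * real N ^ ?X)"
    proof (intro mult_left_mono[OF _ C0] mult_mono)
      \<comment> \<open>For negative \<open>r\<close> the left side is a positive power of 0, which
        uses \<open>N \<ge> 1\<close>, and the right side is an even power.\<close>
      show "s ^ (2 * N) \<le> r ^ (2 * N)"
        using N by (cases "0 \<le> r") (auto simp: s_def max_def power_0_left zero_le_even_power)
      \<comment> \<open>For positive \<open>k\<close> the exponent on the right is larger by
        \<open>l - 1\<close>, with truncated subtraction, so nothing is to spare when
        \<open>l\<close> is 0 or 1.\<close>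
      show "real N ^ (3 * k + 2 * l) \<le> real N ^ ?X"
        using N by (intro power_increasing) auto
    qed auto
    finally show ?thesis
      using integrand_expansion(1)[OF E' F' s] partition_summand_summable(1)[OF N s] E' F'
      unfolding integrand summand_eq by blast
  qed
  show ?thesis
    unfolding Let_def by (rule exI[of _ C]; intro allI impI; rule main; (rule refl | assumption))
qed

end
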